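(* Let $\mathfrak{M}=(V,\langle\cdot,\cdot\rangle,A)$ be a $0$-model of arbitrary signature. If $\mathfrak{M}$ is Puffini--Videv, then $\mathfrak{M}$ may be decomposed as $\mathfrak{M}=\mathfrak{M}_1\oplus\dots\oplus\mathfrak{M}_k$, a direct sum of pseudo-Einstein $0$-models $\mathfrak{M}_i$.
   Context: A $0$-model $\mathfrak{M}=(V,\langle\cdot,\cdot\rangle,A)$ consists of a finite dimensional real vector space $V$, a non-degenerate symmetric inner product $\langle\cdot,\cdot\rangle$ on $V$ of some signature $(p,q)$, and an algebraic curvature tensor $A\in\otimes^4V^*$, i.e. for all $v_i\in V$: $A(v_1,v_2,v_3,v_4)=A(v_3,v_4,v_1,v_2)=-A(v_2,v_1,v_3,v_4)$ and $A(v_1,v_2,v_3,v_4)+A(v_2,v_3,v_1,v_4)+A(v_3,v_1,v_2,v_4)=0$. The curvature operator $\mathcal{A}$ is defined by $\langle\mathcal{A}(v_1,v_2)v_3,v_4\rangle=A(v_1,v_2,v_3,v_4)$, and the Jacobi operator by $\langle\mathcal{J}(v_1)v_2,v_3\rangle=A(v_2,v_1,v_1,v_3)$, i.e. $\mathcal{J}(v)w=\mathcal{A}(w,v)v$. Its polarization is $\mathcal{J}(v_1,v_2)v_3=\frac12\{\mathcal{A}(v_3,v_1)v_2+\mathcal{A}(v_3,v_2)v_1\}$, so $\mathcal{J}(v,v)=\mathcal{J}(v)$. A subspace $\pi\subset V$ is non-degenerate if $\langle\cdot,\cdot\rangle|_\pi$ is non-degenerate. If $v_1,\dots,v_k$ is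 a basis of a non-degenerate $k$-plane $\pi$, put $\xi_{ij}=\langle v_i,v_j\rangle$, let $\xi^{ij}$ be the inverse matrix, and define the higher order Jacobi operator $\mathcal{J}(\pi)=\sum_{i,j=1}^k\xi^{ij}\mathcal{J}(v_i,v_j)$; it is independent of the basis (and $\mathcal{J}(\{0\})=0$). The Ricci operator is $\rho=\mathcal{J}(V)$. $\mathfrak{M}$ is Puffini--Videv if $\mathcal{J}(\pi)\mathcal{J}(\pi^\perp)=\mathcal{J}(\pi^\perp)\mathcal{J}(\pi)$ for every non-degenerate subspace $\pi$ of $V$; equivalently, if $\mathcal{J}(\pi)\rho=\rho\mathcal{J}(\pi)$ for every non-degenerate subspace $\pi$. A $0$-model is pseudo-Einstein if either its Ricci operator $\rho$ has only one (complex) eigenvalue $\lambda$ and $\lambda$ is real, or $\rho$ has exactly two (complex, non-real) eigenvalues $\lambda_1,\lambda_2$, with $\bar\lambda_1=\lambda_2$. ($\rho$ is not required to be diagonalizable.) One writes $\mathfrak{M}=\mathfrak{M}_1\oplus\dots\oplus\mathfrak{M}_k$ (where $k\ge1$; $k=1$ allowed) if there is an orthogonal direct sum decomposition $V=V_1\oplus\dots\oplus V_k$ with $A=A_1\oplus\dots\oplus A_k$, where $A_i=A|_{V_i}\in\otimes^4V_i^*$ (i.e. $A(x_1,x_2,x_3,x_4)=0$ whenever each $x_j$ lies in some $V_i$ but not all four lie in the same $V_i$), and $\mathfrak{M}_i=(V_i,\langle\cdot,\cdot\rangle|_{V_i},A_i)$. *)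

theory Defs
  imports Complex_Main "HOL-Library.FuncSet"
begin

text \<open>
  A 0-model is given by a triple \<open>V g A\<close>. The space \<open>V\<close> is a finite-dimensional subspace of an
  arbitrary real vector space (itself possibly of infinite dimension). The form \<open>g\<close> and the tensor
  \<open>A\<close> are total functions, but only their values on \<open>V\<close> matter: every notion below is relativised
  to the carrier. Hence, for a subspace \<open>W\<close> of \<open>V\<close>, the triple \<open>W g A\<close> is the restricted model.
\<close>

definition linear_form_on :: "'a::real_vector set \<Rightarrow> ('a \<Rightarrow> real) \<Rightarrow> bool" where
  "linear_form_on V f \<longleftrightarrow>
     (\<forall>x\<in>V. \<forall>y\<in>V. f (x + y) = f x + f y) \<and> (\<forall>c. \<forall>x\<in>V. f (c *\<^sub>R x) = c * f x)"

definition fin_dim_subspace :: "'a::real_vector set \<Rightarrow> bool" where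
  "fin_dim_subspace V \<longleftrightarrow> (\<exists>B. finite B \<and> V = span B)"

definition symmetric_bilinear_on :: "'a::real_vector set \<Rightarrow> ('a \<Rightarrow> 'a \<Rightarrow> real) \<Rightarrow> bool" where
  "symmetric_bilinear_on V g \<longleftrightarrow>
     (\<forall>x\<in>V. linear_form_on V (\<lambda>y. g x y)) \<and> (\<forall>y\<in>V. linear_form_on V (\<lambda>x. g x y)) \<and>
     (\<forall>x\<in>V. \<forall>y\<in>V. g x y = g y x)"

definition nondegenerate_on :: "'a::real_vector set \<Rightarrow> ('a \<Rightarrow> 'a \<Rightarrow> real) \<Rightarrow> bool" where
  "nondegenerate_on V g \<longleftrightarrow> (\<forall>x\<in>V. (\<forall>y\<in>V. g x y = 0) \<longrightarrow> x = 0)"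

definition multilinear4_on ::
  "'a::real_vector set \<Rightarrow> ('a \<Rightarrow> 'a \<Rightarrow> 'a \<Rightarrow> 'a \<Rightarrow> real) \<Rightarrow> bool" where
  "multilinear4_on V A \<longleftrightarrow>
     (\<forall>x\<in>V. \<forall>y\<in>V. \<forall>z\<in>V.
        linear_form_on V (\<lambda>v. A v x y z) \<and> linear_form_on V (\<lambda>v. A x v y z) \<and>
        linear_form_on V (\<lambda>v. A x y v z) \<and> linear_form_on V (\<lambda>v. A x y z v))"

definition algebraic_curvature_tensor_on ::
  "'a::real_vector set \<Rightarrow> ('a \<Rightarrow> 'a \<Rightarrow> 'a \<Rightarrow> 'a \<Rightarrow> real) \<Rightarrow> bool" where
  "algebraic_curvature_tensor_on V A \<longleftrightarrow>
     multilinear4_on V A \<and>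
     (\<forall>v1\<in>V. \<forall>v2\<in>V. \<forall>v3\<in>V. \<forall>v4\<in>V.
        A v1 v2 v3 v4 = A v3 v4 v1 v2 \<and>
        A v1 v2 v3 v4 = - A v2 v1 v3 v4 \<and>
        A v1 v2 v3 v4 + A v2 v3 v1 v4 + A v3 v1 v2 v4 = 0)"

definition zero_model ::
  "'a::real_vector set \<Rightarrow> ('a \<Rightarrow> 'a \<Rightarrow> real) \<Rightarrow> ('a \<Rightarrow> 'a \<Rightarrow> 'a \<Rightarrow> 'a \<Rightarrow> real) \<Rightarrow> bool" where
  "zero_model V g A \<longleftrightarrow>
     fin_dim_subspace V \<and> symmetric_bilinear_on V g \<and> nondegenerate_on V g \<and>
     algebraic_curvature_tensor_on V A"

text \<open>The vector below exists and is unique in \<open>V\<close> because \<open>g\<close> is non-degenerate on \<open>V\<close>.\<close>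

definition curvature_operator ::
  "'a::real_vector set \<Rightarrow> ('a \<Rightarrow> 'a \<Rightarrow> real) \<Rightarrow> ('a \<Rightarrow> 'a \<Rightarrow> 'a \<Rightarrow> 'a \<Rightarrow> real) \<Rightarrow> 'a \<Rightarrow> 'a \<Rightarrow> 'a \<Rightarrow> 'a"
where
  "curvature_operator V g A v1 v2 v3 =
     (THE w. w \<in> V \<and> (\<forall>v4\<in>V. g w v4 = A v1 v2 v3 v4))"

definition polarized_jacobi ::
  "'a::real_vector set \<Rightarrow> ('a \<Rightarrow> 'a \<Rightarrow> real) \<Rightarrow> ('a \<Rightarrow> 'a \<Rightarrow> 'a \<Rightarrow> 'a \<Rightarrow> real) \<Rightarrow> 'a \<Rightarrow> 'a \<Rightarrow> 'a \<Rightarrow> 'a"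
where
  "polarized_jacobi V g A v1 v2 v3 =
     (1/2) *\<^sub>R (curvature_operator V g A v3 v1 v2 + curvature_operator V g A v3 v2 v1)"

definition is_basis_of :: "'a::real_vector set \<Rightarrow> 'a set \<Rightarrow> bool" where
  "is_basis_of B U \<longleftrightarrow> independent B \<and> span B = U"

text \<open>
  Gram matrices are indexed by the basis vectors themselves. For a basis of a non-degenerate
  subspace the inverse matrix exists and its entries in \<open>B \<times> B\<close>, the only ones ever used, are
  uniquely determined.
\<close>

definition inverse_gram :: "('a::real_vector \<Rightarrow> 'a \<Rightarrow> real) \<Rightarrow> 'a set \<Rightarrow> 'a \<Rightarrow> 'a \<Rightarrow> real" where
  "inverse_gram g B =
     (SOME \<xi>. \<forall>u\<in>B. \<forall>v\<in>B. (\<Sum>w\<in>B. g u w * \<xi> w v) = (if u = v then 1 else 0))"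

definition higher_jacobi_basis ::
  "'a::real_vector set \<Rightarrow> ('a \<Rightarrow> 'a \<Rightarrow> real) \<Rightarrow> ('a \<Rightarrow> 'a \<Rightarrow> 'a \<Rightarrow> 'a \<Rightarrow> real) \<Rightarrow> 'a set \<Rightarrow> 'a \<Rightarrow> 'a"
where
  "higher_jacobi_basis V g A B x =
     (\<Sum>u\<in>B. \<Sum>v\<in>B. inverse_gram g B u v *\<^sub>R polarized_jacobi V g A u v x)"

text \<open>The value on \<open>V\<close> does not depend on the basis that is chosen.\<close>

definition higher_jacobi ::
  "'a::real_vector set \<Rightarrow> ('a \<Rightarrow> 'a \<Rightarrow> real) \<Rightarrow> ('a \<Rightarrow> 'a \<Rightarrow> 'a \<Rightarrow> 'a \<Rightarrow> real) \<Rightarrow> 'a set \<Rightarrow> 'a \<Rightarrow> 'a"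
where
  "higher_jacobi V g A U = higher_jacobi_basis V g A (SOME B. is_basis_of B U)"

definition ricci_operator ::
  "'a::real_vector set \<Rightarrow> ('a \<Rightarrow> 'a \<Rightarrow> real) \<Rightarrow> ('a \<Rightarrow> 'a \<Rightarrow> 'a \<Rightarrow> 'a \<Rightarrow> real) \<Rightarrow> 'a \<Rightarrow> 'a" where
  "ricci_operator V g A = higher_jacobi V g A V"

definition orthogonal_complement ::
  "'a::real_vector set \<Rightarrow> ('a \<Rightarrow> 'a \<Rightarrow> real) \<Rightarrow> 'a set \<Rightarrow> 'a set" where
  "orthogonal_complement V g U = {x \<in> V. \<forall>y\<in>U. g x y = 0}"

definition Puffini_Videv ::
  "'a::real_vector set \<Rightarrow> ('a \<Rightarrow> 'a \<Rightarrow> real) \<Rightarrow> ('a \<Rightarrow> 'a \<Rightarrow> 'a \<Rightarrow> 'a \<Rightarrow> real) \<Rightarrow> bool" where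
  "Puffini_Videv V g A \<longleftrightarrow>
     (\<forall>U. subspace U \<and> U \<subseteq> V \<and> nondegenerate_on U g \<longrightarrow>
        (\<forall>x\<in>V.
           higher_jacobi V g A U (higher_jacobi V g A (orthogonal_complement V g U) x) =
           higher_jacobi V g A (orthogonal_complement V g U) (higher_jacobi V g A U x)))"

text \<open>
  The complexification of \<open>V\<close> is modelled as \<open>V \<times> V\<close>, the pair \<open>(x, y)\<close> standing for
  \<open>x + i y\<close>; \<open>complexify_scale\<close> is its complex scalar multiplication and \<open>complexify_map T\<close> the
  complex-linear extension of \<open>T\<close>. The complex eigenvalues of a real operator are the eigenvalues
  of this extension.
\<close>

definition complexify_scale :: "complex \<Rightarrow> 'a::real_vector \<times> 'a \<Rightarrow> 'a \<times> 'a" where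
  "complexify_scale c z =
     (Re c *\<^sub>R fst z - Im c *\<^sub>R snd z, Im c *\<^sub>R fst z + Re c *\<^sub>R snd z)"

definition complexify_map :: "('a \<Rightarrow> 'a) \<Rightarrow> 'a \<times> 'a \<Rightarrow> 'a \<times> 'a" where
  "complexify_map T z = (T (fst z), T (snd z))"

definition complex_eigenvalues :: "'a::real_vector set \<Rightarrow> ('a \<Rightarrow> 'a) \<Rightarrow> complex set" where
  "complex_eigenvalues V T =
     {c. \<exists>z \<in> V \<times> V. z \<noteq> (0, 0) \<and> complexify_map T z = complexify_scale c z}"

definition pseudo_Einstein ::
  "'a::real_vector set \<Rightarrow> ('a \<Rightarrow> 'a \<Rightarrow> real) \<Rightarrow> ('a \<Rightarrow> 'a \<Rightarrow> 'a \<Rightarrow> 'a \<Rightarrow> real) \<Rightarrow> bool" where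
  "pseudo_Einstein V g A \<longleftrightarrow>
     (\<exists>c. complex_eigenvalues V (ricci_operator V g A) = {c} \<and> c \<in> \<real>) \<or>
     (\<exists>c1 c2. complex_eigenvalues V (ricci_operator V g A) = {c1, c2} \<and>
        c1 \<noteq> c2 \<and> c1 \<notin> \<real> \<and> c2 \<notin> \<real> \<and> cnj c1 = c2)"

definition model_direct_sum ::
  "'a::real_vector set \<Rightarrow> ('a \<Rightarrow> 'a \<Rightarrow> real) \<Rightarrow> ('a \<Rightarrow> 'a \<Rightarrow> 'a \<Rightarrow> 'a \<Rightarrow> real) \<Rightarrow>
   nat \<Rightarrow> (nat \<Rightarrow> 'a set) \<Rightarrow> bool" where
  "model_direct_sum V g A k W \<longleftrightarrow>
     (\<forall>i<k. subspace (W i) \<and> W i \<subseteq> V) \<and>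
     (\<forall>v\<in>V. \<exists>!w. w \<in> Pi\<^sub>E {..<k} W \<and> v = (\<Sum>i<k. w i)) \<and>
     (\<forall>i<k. \<forall>j<k. i \<noteq> j \<longrightarrow> (\<forall>x\<in>W i. \<forall>y\<in>W j. g x y = 0)) \<and>
     (\<forall>i1<k. \<forall>i2<k. \<forall>i3<k. \<forall>i4<k. \<not> (i1 = i2 \<and> i2 = i3 \<and> i3 = i4) \<longrightarrow>
        (\<forall>x1\<in>W i1. \<forall>x2\<in>W i2. \<forall>x3\<in>W i3. \<forall>x4\<in>W i4. A x1 x2 x3 x4 = 0))"

end

theory Submission
  imports Defs "HOL-Computational_Algebra.Computational_Algebra"
    "HOL-Computational_Algebra.Field_as_Ring"
begin

text \<open>
  Write \<open>\<rho>\<close> for the Ricci operator and \<open>J(u, v)\<close> for the polarized Jacobi operator.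
  
  For a non-null vector \<open>v\<close> the line through \<open>v\<close> is non-degenerate, its higher order Jacobi operator is
  \<open>J(v, v) / g v v\<close>, and this operator and the one of the orthogonal hyperplane add up to \<open>\<rho>\<close>. So the
  Puffini--Videv condition says that \<open>J(v, v)\<close> commutes with \<open>\<rho>\<close>. The null vectors and the mixed
  operators \<open>J(u, v)\<close> follow because a quadratic form that vanishes off the null cone is zero. As \<open>\<rho>\<close>
  is self-adjoint, the result reads (\<open>jacobi_form_ricci_self_adjoint\<close>): \<open>\<rho>\<close> is self-adjoint for \<open>g\<close> and
  for every form \<open>g (J(u, v) x) y\<close> in \<open>x, y\<close>.
  
  Over the reals \<open>V\<close> is the sum of the kernels \<open>W\<^sub>p\<close> of \<open>p(\<rho>)^n\<close> with \<open>p\<close> irreducible. By Bezout, any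
  form for which \<open>\<rho>\<close> is self-adjoint pairs different \<open>W\<^sub>p\<close> to zero (\<open>coprime_kernels_orthogonal\<close>). For
  \<open>g\<close> this says that the sum is orthogonal. The form \<open>g (J(u, v) x) y\<close> is also symmetric under exchange of
  the pairs \<open>(u, v)\<close> and \<open>(x, y)\<close>, so it vanishes unless \<open>u, v\<close> lie in one \<open>W\<^sub>p\<close> and \<open>x, y\<close> lie in
  one \<open>W\<^sub>q\<close>. The Bianchi identity recovers \<open>A\<close> from these forms, and the remaining case \<open>p \<noteq> q\<close> is
  excluded by the numerical clash \<open>3 A = 2 A\<close> (\<open>curvature_vanishes_on_mixed_arguments\<close>).
  
  Hence the model splits along the \<open>W\<^sub>p\<close>. The Ricci operator of a summand is the restriction of \<open>\<rho>\<close>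
  (\<open>ricci_operator_component\<close>), and an operator that is annihilated by a power of an irreducible real
  polynomial has spectrum \<open>{c, cnj c}\<close>, since real irreducible polynomials have only such roots
  (\<open>eigenvalues_of_primary_component\<close>).
\<close>

section \<open>Forms on a subspace\<close>

lemma linear_form_on_sum:
  assumes "subspace V" "linear_form_on V f" "\<And>i. i \<in> I \<Longrightarrow> x i \<in> V"
  shows "f (\<Sum>i\<in>I. c i *\<^sub>R x i) = (\<Sum>i\<in>I. c i * f (x i))"
proof -
  have z: "f 0 = 0"
    using assms(1,2) subspace_0[of V] unfolding linear_form_on_def
    by (metis mult_zero_left scaleR_zero_left)
  show ?thesis
    using assms(3)
  proof (induction I rule: infinite_finite_induct)
    case (insert i I)
    have "(\<Sum>i\<in>I. c i *\<^sub>R x i) \<in> V" "c i *\<^sub>R x i \<in> V"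
      using assms(1) insert.prems by (auto intro!: subspace_sum subspace_scale)
    with insert assms(2) show ?case by (simp add: linear_form_on_def)
  qed (use z in auto)
qed

text \<open>
  Besides \<open>g\<close>, forms that are not known to be symmetric occur, in particular those obtained by fixing
  two arguments of the curvature tensor.
\<close>

definition bilinear_on :: "'a::real_vector set \<Rightarrow> ('a \<Rightarrow> 'a \<Rightarrow> real) \<Rightarrow> bool" where
  "bilinear_on V h \<longleftrightarrow>
     (\<forall>x\<in>V. linear_form_on V (\<lambda>y. h x y)) \<and> (\<forall>y\<in>V. linear_form_on V (\<lambda>x. h x y))"

lemma linear_form_on_subset: "linear_form_on V f \<Longrightarrow> W \<subseteq> V \<Longrightarrow> linear_form_on W f"
  unfolding linear_form_on_def by blast

lemma bilinear_on_subset: "bilinear_on V h \<Longrightarrow> W \<subseteq> V \<Longrightarrow> bilinear_on W h"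
  unfolding bilinear_on_def using linear_form_on_subset by blast

lemma symmetric_bilinear_on_subset:
  "symmetric_bilinear_on V g \<Longrightarrow> W \<subseteq> V \<Longrightarrow> symmetric_bilinear_on W g"
  unfolding symmetric_bilinear_on_def using linear_form_on_subset by blast

lemma symmetric_imp_bilinear_on: "symmetric_bilinear_on V g \<Longrightarrow> bilinear_on V g"
  unfolding symmetric_bilinear_on_def bilinear_on_def by blast

lemma symmetric_bilinear_onD:
  "symmetric_bilinear_on V g \<Longrightarrow> x \<in> V \<Longrightarrow> y \<in> V \<Longrightarrow> g x y = g y x"
  unfolding symmetric_bilinear_on_def by blast

lemma bilinear_on_sum_left:
  assumes "subspace V" "bilinear_on V h" "\<And>i. i \<in> I \<Longrightarrow> x i \<in> V" "y \<in> V"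
  shows "h (\<Sum>i\<in>I. c i *\<^sub>R x i) y = (\<Sum>i\<in>I. c i * h (x i) y)"
  using linear_form_on_sum[of V "\<lambda>x. h x y" I x c] assms unfolding bilinear_on_def by blast

lemma bilinear_on_sum_right:
  assumes "subspace V" "bilinear_on V h" "\<And>i. i \<in> I \<Longrightarrow> x i \<in> V" "y \<in> V"
  shows "h y (\<Sum>i\<in>I. c i *\<^sub>R x i) = (\<Sum>i\<in>I. c i * h y (x i))"
  using linear_form_on_sum[of V "\<lambda>x. h y x" I x c] assms unfolding bilinear_on_def by blast

lemma bilinear_on_simps:
  assumes "bilinear_on V h" "x \<in> V" "y \<in> V" "z \<in> V"
  shows "h (x + y) z = h x z + h y z" "h z (x + y) = h z x + h z y"
    "h (c *\<^sub>R x) z = c * h x z" "h z (c *\<^sub>R x) = c * h z x"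
  using assms unfolding bilinear_on_def linear_form_on_def by blast+

lemma bilinear_on_zero:
  assumes "bilinear_on V h" "subspace V" "z \<in> V"
  shows "h 0 z = 0" "h z 0 = 0"
  using bilinear_on_simps(3,4)[OF assms(1) subspace_0[OF assms(2)] assms(3,3), of 0] by auto

lemma bilinear_on_diff:
  assumes "bilinear_on V h" "subspace V" "x \<in> V" "y \<in> V" "z \<in> V"
  shows "h (x - y) z = h x z - h y z" "h z (x - y) = h z x - h z y"
proof -
  have "x - y = x + (-1) *\<^sub>R y" "(-1) *\<^sub>R y \<in> V"
    using assms by (auto simp: subspace_neg)
  then show "h (x - y) z = h x z - h y z" "h z (x - y) = h z x - h z y"
    using bilinear_on_simps[OF assms(1)] assms(3-5) by (metis diff_conv_add_uminus mult_minus1)+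
qed

text \<open>
  Jacobi and Ricci operators are accessible only through their pairings with \<open>g\<close>; this is the way
  back to identities between vectors.
\<close>

lemma nondegenerate_eqI:
  assumes "bilinear_on V g" "subspace V" "nondegenerate_on V g" "x \<in> V" "y \<in> V"
    and "\<And>z. z \<in> V \<Longrightarrow> g x z = g y z"
  shows "x = y"
proof -
  have "x - y \<in> V" using assms by (simp add: subspace_diff)
  moreover have "g (x - y) z = 0" if "z \<in> V" for z
    using bilinear_on_diff(1)[OF assms(1,2,4,5) that] assms(6)[OF that] by simp
  ultimately have "x - y = 0" using assms(3) unfolding nondegenerate_on_def by blast
  then show ?thesis by simp
qed

lemma fin_dim_subspace_subset:
  assumes "fin_dim_subspace V" "subspace U" "U \<subseteq> V"
  obtains B where "finite B" "is_basis_of B U"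
proof -
  from assms(1) obtain T where T: "finite T" "V = span T" unfolding fin_dim_subspace_def by blast
  obtain B where B: "B \<subseteq> U" "independent B" "U \<subseteq> span B" using maximal_independent_subset by blast
  have "finite B" using independent_span_bound[OF T(1) B(2)] B(1) assms(3) T(2) by blast
  moreover have "span B = U" using B span_minimal[OF B(1) assms(2)] by blast
  ultimately show ?thesis using that B unfolding is_basis_of_def by blast
qed

lemma fin_dim_subspace_imp_subspace: "fin_dim_subspace V \<Longrightarrow> subspace V"
  unfolding fin_dim_subspace_def by auto

lemma is_basis_of_finite:
  assumes "fin_dim_subspace V" "U \<subseteq> V" "is_basis_of B U"
  shows "finite B"
proof -
  from assms(1) obtain T where T: "finite T" "V = span T" unfolding fin_dim_subspace_def by blast
  then show ?thesis
    using independent_span_bound[OF T(1), of B] assms(2,3) span_superset[of B]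
    unfolding is_basis_of_def by blast
qed

section \<open>Frames and traces\<close>

text \<open>
  A frame is a basis together with its dual basis, except that linear independence is dropped and the
  indices are free. Frames of orthogonal summands can then simply be put side by side, and no basis of
  the whole space has to be assembled.
\<close>

definition frame_of ::
  "'a::real_vector set \<Rightarrow> ('a \<Rightarrow> 'a \<Rightarrow> real) \<Rightarrow> 'i set \<Rightarrow> ('i \<Rightarrow> 'a) \<Rightarrow> ('i \<Rightarrow> 'a) \<Rightarrow> bool" where
  "frame_of U g I e f \<longleftrightarrow> finite I \<and> e ` I \<subseteq> U \<and> f ` I \<subseteq> U \<and>
     (\<forall>x\<in>U. x = (\<Sum>i\<in>I. g x (f i) *\<^sub>R e i))"

text \<open>
  Both sides have the same pairing with every vector: expand that vector in the given frame.
\<close>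

lemma frame_of_swap:
  assumes "subspace U" "symmetric_bilinear_on U g" "nondegenerate_on U g" "frame_of U g I e f"
  shows "frame_of U g I f e"
proof -
  note b = symmetric_imp_bilinear_on[OF assms(2)]
  have e: "e i \<in> U" and f: "f i \<in> U" if "i \<in> I" for i
    using assms(4) that unfolding frame_of_def by auto
  have "x = (\<Sum>i\<in>I. g x (e i) *\<^sub>R f i)" if x: "x \<in> U" for x
  proof (rule nondegenerate_eqI[OF b assms(1,3) x])
    show "(\<Sum>i\<in>I. g x (e i) *\<^sub>R f i) \<in> U"
      using f assms(1) by (intro subspace_sum subspace_scale) auto
    fix y assume y: "y \<in> U"
    have "g x y = g x (\<Sum>i\<in>I. g y (f i) *\<^sub>R e i)"
      using assms(4) y unfolding frame_of_def by metis
    also have "\<dots> = (\<Sum>i\<in>I. g y (f i) * g x (e i))"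
      by (rule bilinear_on_sum_right[OF assms(1) b e x])
    also have "\<dots> = (\<Sum>i\<in>I. g x (e i) * g (f i) y)"
      using f y symmetric_bilinear_onD[OF assms(2)] by (intro sum.cong) auto
    also have "\<dots> = g (\<Sum>i\<in>I. g x (e i) *\<^sub>R f i) y"
      by (rule bilinear_on_sum_left[OF assms(1) b f y, symmetric])
    finally show "g x y = g (\<Sum>i\<in>I. g x (e i) *\<^sub>R f i) y" .
  qed
  then show ?thesis using assms(4) unfolding frame_of_def by blast
qed

text \<open>
  Expand \<open>e i\<close> in the second frame; after the two sums are exchanged, the inner one is the expansion of
  \<open>f' k\<close> in the first. This is the basis independence of the higher order Jacobi operators, and it
  allows each of them to be computed in a frame suited to the situation.
\<close>

lemma frame_trace_unique:
  assumes U: "subspace U" "symmetric_bilinear_on U g" "nondegenerate_on U g"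
    and F: "frame_of U g I e f" and F': "frame_of U g K e' f'" and h: "bilinear_on U h"
  shows "(\<Sum>i\<in>I. h (e i) (f i)) = (\<Sum>k\<in>K. h (e' k) (f' k))"
proof -
  have e: "e i \<in> U" and f: "f i \<in> U" if "i \<in> I" for i
    using F that unfolding frame_of_def by auto
  have e': "e' i \<in> U" and f': "f' i \<in> U" if "i \<in> K" for i
    using F' that unfolding frame_of_def by auto
  note S = frame_of_swap[OF U F]
  have "(\<Sum>i\<in>I. h (e i) (f i)) = (\<Sum>i\<in>I. \<Sum>k\<in>K. g (e i) (f' k) * h (e' k) (f i))"
  proof (rule sum.cong[OF refl])
    fix i assume i: "i \<in> I"
    have "h (e i) (f i) = h (\<Sum>k\<in>K. g (e i) (f' k) *\<^sub>R e' k) (f i)"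
      using F' e[OF i] unfolding frame_of_def by metis
    also have "\<dots> = (\<Sum>k\<in>K. g (e i) (f' k) * h (e' k) (f i))"
      by (rule bilinear_on_sum_left[OF U(1) h e' f[OF i]])
    finally show "h (e i) (f i) = (\<Sum>k\<in>K. g (e i) (f' k) * h (e' k) (f i))" .
  qed
  also have "\<dots> = (\<Sum>k\<in>K. \<Sum>i\<in>I. g (e i) (f' k) * h (e' k) (f i))" by (rule sum.swap)
  also have "\<dots> = (\<Sum>k\<in>K. h (e' k) (f' k))"
  proof (rule sum.cong[OF refl])
    fix k assume k: "k \<in> K"
    have "h (e' k) (f' k) = h (e' k) (\<Sum>i\<in>I. g (f' k) (e i) *\<^sub>R f i)"
      using S f'[OF k] unfolding frame_of_def by metis
    also have "\<dots> = (\<Sum>i\<in>I. g (f' k) (e i) * h (e' k) (f i))"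
      by (rule bilinear_on_sum_right[OF U(1) h f e'[OF k]])
    also have "\<dots> = (\<Sum>i\<in>I. g (e i) (f' k) * h (e' k) (f i))"
      using e f'[OF k] symmetric_bilinear_onD[OF U(2)] by (intro sum.cong) auto
    finally show "(\<Sum>i\<in>I. g (e i) (f' k) * h (e' k) (f i)) = h (e' k) (f' k)" ..
  qed
  finally show ?thesis .
qed

lemma frame_of_dual_family:
  assumes "subspace U" "bilinear_on U g" "finite B" "is_basis_of B U"
    and d: "\<And>b. b \<in> B \<Longrightarrow> d b \<in> U"
    and \<delta>: "\<And>a b. a \<in> B \<Longrightarrow> b \<in> B \<Longrightarrow> g a (d b) = (if a = b then 1 else 0)"
  shows "frame_of U g B (\<lambda>b. b) d"
proof -
  have BU: "b \<in> U" if "b \<in> B" for b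
    using assms(4) that span_base unfolding is_basis_of_def by blast
  have "x = (\<Sum>i\<in>B. g x (d i) *\<^sub>R i)" if "x \<in> U" for x
  proof -
    have "x \<in> range (\<lambda>u. \<Sum>v\<in>B. u v *\<^sub>R v)"
      using assms(3,4) that span_finite[of B] unfolding is_basis_of_def by auto
    then obtain u where u: "x = (\<Sum>v\<in>B. u v *\<^sub>R v)" by blast
    have "g x (d i) = u i" if i: "i \<in> B" for i
    proof -
      have "g x (d i) = (\<Sum>v\<in>B. u v * g v (d i))"
        unfolding u by (rule bilinear_on_sum_left[OF assms(1,2) BU d[OF i]])
      also have "\<dots> = (\<Sum>v\<in>B. if v = i then u v else 0)"
        using i \<delta> by (intro sum.cong) auto
      also have "\<dots> = u i" using i assms(3) by simp
      finally show ?thesis .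
    qed
    then show ?thesis using u by simp
  qed
  then show ?thesis unfolding frame_of_def using assms(3) BU d by auto
qed

text \<open>
  The endomorphism \<open>x \<mapsto> (\<Sum>c\<in>B. g x c *\<^sub>R c)\<close> of \<open>U\<close> is injective because \<open>g\<close> is non-degenerate,
  hence surjective by counting; the preimage of \<open>b\<close> is the dual vector of \<open>b\<close>.
\<close>

lemma dual_family_exists:
  assumes "subspace U" "symmetric_bilinear_on U g" "nondegenerate_on U g"
    and "finite B" "is_basis_of B U"
  obtains d where "\<And>b. b \<in> B \<Longrightarrow> d b \<in> U"
    "\<And>a b. a \<in> B \<Longrightarrow> b \<in> B \<Longrightarrow> g a (d b) = (if a = b then 1 else 0)"
proof -
  note b = symmetric_imp_bilinear_on[OF assms(2)]
  have ind: "independent B" and sp: "span B = U" using assms(5) unfolding is_basis_of_def by auto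
  have BU: "b \<in> U" if "b \<in> B" for b using sp that span_base by blast
  define \<Psi> where "\<Psi> x = (\<Sum>c\<in>B. g x c *\<^sub>R c)" for x
  \<comment> \<open>The bilinearity of \<open>g\<close> is confined to \<open>U\<close>, so \<open>\<Psi>\<close> is replaced by a globally linear map.\<close>
  obtain F where F: "linear F" "\<And>x. x \<in> B \<Longrightarrow> F x = \<Psi> x"
    using linear_independent_extend[OF ind, of \<Psi>] by blast
  have ex: "\<exists>u. x = (\<Sum>v\<in>B. u v *\<^sub>R v)" if "x \<in> U" for x
    using assms(4) that span_finite[of B] sp by auto
  have FU: "F x = \<Psi> x" if x: "x \<in> U" for x
  proof -
    obtain u where u: "x = (\<Sum>v\<in>B. u v *\<^sub>R v)" using ex[OF x] by blast
    have "F x = (\<Sum>v\<in>B. u v *\<^sub>R \<Psi> v)"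
      unfolding u using F by (simp add: linear_sum linear_cmul)
    also have "\<dots> = (\<Sum>c\<in>B. (\<Sum>v\<in>B. u v * g v c) *\<^sub>R c)"
      unfolding \<Psi>_def by (simp add: scaleR_sum_right scaleR_sum_left, rule sum.swap)
    also have "\<dots> = \<Psi> x"
      unfolding \<Psi>_def u using bilinear_on_sum_left[OF assms(1) b BU BU, of B "\<lambda>x. x"]
      by (intro sum.cong) (auto simp: bilinear_on_sum_left[OF assms(1) b] BU)
    finally show ?thesis .
  qed
  have coord: "u c = w c" if "(\<Sum>v\<in>B. u v *\<^sub>R v) = (\<Sum>v\<in>B. w v *\<^sub>R v)" "c \<in> B" for u w c
    using independentD[OF ind assms(4) subset_refl, of "\<lambda>v. u v - w v" c] that
    by (simp add: scaleR_diff_left sum_subtractf)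
  have inj: "inj_on F (span B)"
  proof (subst linear_inj_on_iff_eq_0[OF F(1) subspace_span], intro ballI impI)
    fix x assume x: "x \<in> span B" "F x = 0"
    then have xU: "x \<in> U" using sp by simp
    have z: "g x c = 0" if "c \<in> B" for c
      using coord[of "\<lambda>c. g x c" "\<lambda>_. 0" c] x(2) FU[OF xU] that unfolding \<Psi>_def by simp
    have "g x y = 0" if y: "y \<in> U" for y
    proof -
      obtain u where u: "y = (\<Sum>v\<in>B. u v *\<^sub>R v)" using ex[OF y] by blast
      show ?thesis unfolding u
        by (subst bilinear_on_sum_right[OF assms(1) b BU xU]) (use z in auto)
    qed
    then show "x = 0" using assms(3) xU unfolding nondegenerate_on_def by blast
  qed
  have indF: "independent (F ` B)"
    using linear_independent_injective_image[OF F(1) ind inj] .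
  have FB: "F ` B \<subseteq> span B"
    using F(2) sp unfolding \<Psi>_def by (auto intro!: span_sum span_scale intro: span_base)
  have "card (F ` B) = card B"
    using inj_on_subset[OF inj span_superset] by (rule card_image)
  \<comment> \<open>The image of \<open>B\<close> is independent and as large as \<open>B\<close>, so no vector of \<open>U\<close> can be added to it.\<close>
  have "span B \<subseteq> span (F ` B)"
  proof (rule subsetI, rule ccontr)
    fix x assume x: "x \<in> span B" "x \<notin> span (F ` B)"
    then have "independent (insert x (F ` B))" using indF independent_insertI by blast
    then have "card (insert x (F ` B)) \<le> card B"
      using independent_span_bound[OF assms(4), of "insert x (F ` B)"] FB x(1) by blast
    moreover have "x \<notin> F ` B" using x(2) span_base by blast
    ultimately show False using \<open>card (F ` B) = card B\<close> assms(4) by simp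
  qed
  then have "span B \<subseteq> F ` span B" using linear_span_image[OF F(1)] by blast
  then have "\<forall>b\<in>B. \<exists>x. x \<in> U \<and> F x = b" using sp span_base by blast
  then obtain d where d: "\<And>b. b \<in> B \<Longrightarrow> d b \<in> U" "\<And>b. b \<in> B \<Longrightarrow> F (d b) = b"
    by metis
  show thesis
  proof (rule that[of d])
    fix a b assume ab: "a \<in> B" "b \<in> B"
    have "(\<Sum>v\<in>B. g (d b) v *\<^sub>R v) = (\<Sum>v\<in>B. (if v = b then 1 else 0) *\<^sub>R v)"
      using d(2)[OF ab(2)] FU[OF d(1)[OF ab(2)]] ab assms(4)
      unfolding \<Psi>_def by (simp add: if_distrib[of "\<lambda>c. c *\<^sub>R _"] cong: if_cong)
    then have "g (d b) a = (if a = b then 1 else 0)" using coord ab(1) by fastforce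
    then show "g a (d b) = (if a = b then 1 else 0)"
      using symmetric_bilinear_onD[OF assms(2) BU[OF ab(1)] d(1)[OF ab(2)]] by simp
  qed (use d in auto)
qed

lemma frame_exists:
  assumes "fin_dim_subspace V" "subspace U" "U \<subseteq> V" "symmetric_bilinear_on U g" "nondegenerate_on U g"
  obtains B d where "frame_of U g B (\<lambda>b. b) d"
proof -
  obtain B where B: "finite B" "is_basis_of B U" using fin_dim_subspace_subset[OF assms(1-3)] .
  obtain d where "\<And>b. b \<in> B \<Longrightarrow> d b \<in> U"
    "\<And>a b. a \<in> B \<Longrightarrow> b \<in> B \<Longrightarrow> g a (d b) = (if a = b then 1 else 0)"
    using dual_family_exists[OF assms(2,4,5) B] by blast
  then show ?thesis
    by (intro that[OF frame_of_dual_family[OF assms(2) symmetric_imp_bilinear_on[OF assms(4)] B]])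
qed

text \<open>
  This gives the definite description in the definition of the curvature operator its meaning.
\<close>

lemma form_represented_by_unique_vector:
  assumes "fin_dim_subspace V" "symmetric_bilinear_on V g" "nondegenerate_on V g"
    and "linear_form_on V \<phi>"
  shows "\<exists>!w. w \<in> V \<and> (\<forall>y\<in>V. g w y = \<phi> y)"
proof -
  note sV = fin_dim_subspace_imp_subspace[OF assms(1)] and b = symmetric_imp_bilinear_on[OF assms(2)]
  obtain B d where F: "frame_of V g B (\<lambda>b. b) d"
    using frame_exists[OF assms(1) sV subset_refl assms(2,3)] .
  then have B: "b \<in> V" and d: "d b \<in> V" if "b \<in> B" for b
    using that unfolding frame_of_def by auto
  define w where "w = (\<Sum>b\<in>B. \<phi> b *\<^sub>R d b)"
  have w: "w \<in> V" unfolding w_def using d sV by (intro subspace_sum subspace_scale) auto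
  have "g w y = \<phi> y" if y: "y \<in> V" for y
  proof -
    have "g w y = (\<Sum>b\<in>B. \<phi> b * g (d b) y)"
      unfolding w_def by (rule bilinear_on_sum_left[OF sV b d y])
    also have "\<dots> = (\<Sum>b\<in>B. g y (d b) * \<phi> b)"
      using d y symmetric_bilinear_onD[OF assms(2)] by (intro sum.cong) auto
    also have "\<dots> = \<phi> (\<Sum>b\<in>B. g y (d b) *\<^sub>R b)"
      by (rule linear_form_on_sum[OF sV assms(4) B, symmetric])
    also have "\<dots> = \<phi> y" using F y unfolding frame_of_def by metis
    finally show ?thesis .
  qed
  then show ?thesis using w nondegenerate_eqI[OF b sV assms(3)] by metis
qed

lemma frame_of_orthogonal_sum:
  assumes V: "subspace V" "symmetric_bilinear_on V g" and "U \<subseteq> V" "C \<subseteq> V"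
    and sum: "\<And>x. x \<in> V \<Longrightarrow> \<exists>y\<in>U. \<exists>z\<in>C. x = y + z"
    and orth: "\<And>y z. y \<in> U \<Longrightarrow> z \<in> C \<Longrightarrow> g y z = 0"
    and F: "frame_of U g I e f" and F': "frame_of C g K e' f'"
  shows "frame_of V g (I <+> K) (case_sum e e') (case_sum f f')"
proof -
  note b = symmetric_imp_bilinear_on[OF V(2)]
  have "x = (\<Sum>i\<in>I <+> K. g x (case_sum f f' i) *\<^sub>R case_sum e e' i)" if x: "x \<in> V" for x
  proof -
    obtain y z where yz: "y \<in> U" "z \<in> C" "x = y + z" using sum[OF x] by blast
    have 1: "g x (f i) = g y (f i)" if "i \<in> I" for i
    proof -
      have fi: "f i \<in> U" using F that unfolding frame_of_def by auto
      then have "g z (f i) = 0"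
        using orth[OF fi yz(2)] symmetric_bilinear_onD[OF V(2), of z "f i"] yz(2) assms(3,4) by auto
      then show ?thesis
        unfolding yz(3) using bilinear_on_simps(1)[OF b, of y z "f i"] yz assms(3,4) fi by auto
    qed
    have 2: "g x (f' i) = g z (f' i)" if "i \<in> K" for i
    proof -
      have fi: "f' i \<in> C" using F' that unfolding frame_of_def by auto
      then show ?thesis
        unfolding yz(3) using bilinear_on_simps(1)[OF b, of y z "f' i"] yz assms(3,4) fi
          orth[OF yz(1) fi] by auto
    qed
    have "(\<Sum>i\<in>I <+> K. g x (case_sum f f' i) *\<^sub>R case_sum e e' i)
        = (\<Sum>i\<in>I. g x (f i) *\<^sub>R e i) + (\<Sum>i\<in>K. g x (f' i) *\<^sub>R e' i)"
      using F F' unfolding frame_of_def by (simp add: sum.Plus)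
    also have "\<dots> = (\<Sum>i\<in>I. g y (f i) *\<^sub>R e i) + (\<Sum>i\<in>K. g z (f' i) *\<^sub>R e' i)"
      using 1 2 by simp
    also have "\<dots> = x"
      using F F' yz unfolding frame_of_def by metis
    finally show ?thesis ..
  qed
  moreover have "e i \<in> V" "f i \<in> V" if "i \<in> I" for i
    using that F assms(3) unfolding frame_of_def by blast+
  moreover have "e' i \<in> V" "f' i \<in> V" if "i \<in> K" for i
    using that F' assms(4) unfolding frame_of_def by blast+
  ultimately have "case_sum e e' ` (I <+> K) \<subseteq> V" "case_sum f f' ` (I <+> K) \<subseteq> V"
    "\<forall>x\<in>V. x = (\<Sum>i\<in>I <+> K. g x (case_sum f f' i) *\<^sub>R case_sum e e' i)"
    by auto
  moreover have "finite (I <+> K)" using F F' unfolding frame_of_def by simp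
  ultimately show ?thesis unfolding frame_of_def by blast
qed

text \<open>
  The projection onto \<open>U\<close> is \<open>x \<mapsto> (\<Sum>b. g x (d b) *\<^sub>R b)\<close> for any frame of \<open>U\<close>.
\<close>

lemma orthogonal_complement_splits:
  assumes V: "fin_dim_subspace V" "symmetric_bilinear_on V g" "nondegenerate_on V g"
    and U: "subspace U" "U \<subseteq> V" "nondegenerate_on U g"
  shows "subspace (orthogonal_complement V g U)" "orthogonal_complement V g U \<subseteq> V"
    "x \<in> V \<Longrightarrow> \<exists>y\<in>U. \<exists>z\<in>orthogonal_complement V g U. x = y + z"
    "y \<in> U \<Longrightarrow> z \<in> orthogonal_complement V g U \<Longrightarrow> g y z = 0"
    "nondegenerate_on (orthogonal_complement V g U) g"
proof -
  let ?C = "orthogonal_complement V g U"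
  note sV = fin_dim_subspace_imp_subspace[OF V(1)] and b = symmetric_imp_bilinear_on[OF V(2)]
  show C: "subspace ?C"
    unfolding subspace_def orthogonal_complement_def using sV U(2) bilinear_on_zero[OF b sV]
    by (auto simp: subspace_add subspace_scale subspace_0 bilinear_on_simps[OF b] subset_iff)
  show CV: "?C \<subseteq> V" unfolding orthogonal_complement_def by blast
  show orth: "g y z = 0" if "y \<in> U" "z \<in> ?C" for y z
    using that symmetric_bilinear_onD[OF V(2), of y z] U(2) unfolding orthogonal_complement_def by auto
  note gU = symmetric_bilinear_on_subset[OF V(2) U(2)]
  obtain B d where F: "frame_of U g B (\<lambda>b. b) d"
    using frame_exists[OF V(1) U(1,2) gU U(3)] .
  then have B: "b \<in> U" and d: "d b \<in> U" if "b \<in> B" for b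
    using that unfolding frame_of_def by auto
  have F': "frame_of U g B d (\<lambda>b. b)" using frame_of_swap[OF U(1) gU U(3) F] .
  show split: "\<exists>y\<in>U. \<exists>z\<in>?C. x = y + z" if x: "x \<in> V" for x
  proof -
    define y where "y = (\<Sum>b\<in>B. g x (d b) *\<^sub>R b)"
    have y: "y \<in> U" unfolding y_def using U(1) B by (intro subspace_sum subspace_scale) auto
    have "g (x - y) u = 0" if u: "u \<in> U" for u
    proof -
      have "g x u = g x (\<Sum>b\<in>B. g u b *\<^sub>R d b)"
        using F' u unfolding frame_of_def by metis
      also have "\<dots> = (\<Sum>b\<in>B. g u b * g x (d b))"
        using d U(2) by (intro bilinear_on_sum_right[OF sV b _ x]) auto
      also have "\<dots> = (\<Sum>b\<in>B. g x (d b) * g b u)"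
        using symmetric_bilinear_onD[OF gU u] B by (intro sum.cong) auto
      also have "\<dots> = g y u"
        unfolding y_def using B U(2) u by (intro bilinear_on_sum_left[OF sV b, symmetric]) auto
      finally show ?thesis using bilinear_on_diff(1)[OF b sV x, of y u] y u U(2) by auto
    qed
    moreover have "x - y \<in> V" using x y U(2) sV by (auto intro: subspace_diff)
    ultimately have "x - y \<in> ?C" unfolding orthogonal_complement_def by blast
    with y show ?thesis by (metis add.commute diff_add_cancel)
  qed
  show "nondegenerate_on ?C g"
    unfolding nondegenerate_on_def
  proof (intro ballI impI)
    fix x assume x: "x \<in> ?C" "\<forall>y\<in>?C. g x y = 0"
    have "g x v = 0" if v: "v \<in> V" for v
    proof -
      obtain y z where yz: "y \<in> U" "z \<in> ?C" "v = y + z" using split[OF v] by blast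
      have "g x y = 0" using x(1) yz(1) unfolding orthogonal_complement_def by blast
      then show ?thesis
        unfolding yz(3) using bilinear_on_simps(2)[OF b, of y z x] yz x CV U(2) by auto
    qed
    then show "x = 0" using V(3) x(1) CV unfolding nondegenerate_on_def by blast
  qed
qed

section \<open>Jacobi operators as traces\<close>

text \<open>
  This is \<open>g (J(u, v) x) y\<close> for the polarized Jacobi operator \<open>J(u, v)\<close>, expressed by \<open>A\<close> alone and
  therefore the same for a model and for its restrictions.
\<close>

definition jacobi_form ::
  "('a \<Rightarrow> 'a \<Rightarrow> 'a \<Rightarrow> 'a \<Rightarrow> real) \<Rightarrow> 'a \<Rightarrow> 'a \<Rightarrow> 'a \<Rightarrow> 'a \<Rightarrow> real" where
  "jacobi_form A u v x y = (A x u v y + A x v u y) / 2"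

lemma zero_modelD:
  assumes "zero_model V g A"
  shows "fin_dim_subspace V" "subspace V" "symmetric_bilinear_on V g" "bilinear_on V g"
    "nondegenerate_on V g" "multilinear4_on V A" "algebraic_curvature_tensor_on V A"
  using assms fin_dim_subspace_imp_subspace symmetric_imp_bilinear_on
  unfolding zero_model_def algebraic_curvature_tensor_on_def by blast+

lemma curvature_symmetries:
  assumes "algebraic_curvature_tensor_on V A" "a \<in> V" "b \<in> V" "c \<in> V" "d \<in> V"
  shows "A a b c d = A c d a b" "A a b c d = - A b a c d" "A a b c d = - A a b d c"
    "A a b c d + A b c a d + A c a b d = 0"
  using assms unfolding algebraic_curvature_tensor_on_def by metis+

lemma linear_form_on_comb:
  assumes "linear_form_on V f" "linear_form_on V f'"
  shows "linear_form_on V (\<lambda>x. (f x + f' x) / 2)"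
  using assms unfolding linear_form_on_def by (auto simp: field_simps)

lemma jacobi_form_bilinear:
  assumes "algebraic_curvature_tensor_on V A" "x \<in> V" "y \<in> V"
  shows "bilinear_on V (\<lambda>u v. jacobi_form A u v x y)" "bilinear_on V (jacobi_form A x y)"
  using assms unfolding bilinear_on_def jacobi_form_def algebraic_curvature_tensor_on_def
    multilinear4_on_def
  by (auto intro!: linear_form_on_comb)

text \<open>
  The last symmetry is decisive later on: an operator that can be moved between \<open>x\<close> and \<open>y\<close> can then also be
  moved between \<open>u\<close> and \<open>v\<close>.
\<close>

lemma jacobi_form_symmetries:
  assumes "algebraic_curvature_tensor_on V A" "u \<in> V" "v \<in> V" "x \<in> V" "y \<in> V"
  shows "jacobi_form A u v x y = jacobi_form A v u x y"
    "jacobi_form A u v x y = jacobi_form A u v y x"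
    "jacobi_form A u v x y = jacobi_form A x y u v"
proof -
  note c = curvature_symmetries[OF assms(1)]
  show "jacobi_form A u v x y = jacobi_form A v u x y" unfolding jacobi_form_def by simp
  have swap: "A a b c d = A d c b a" "A a b c d = A b a d c"
    if "a \<in> V" "b \<in> V" "c \<in> V" "d \<in> V" for a b c d
    using c(1)[OF that] c(2)[OF that(3,4,1,2)] c(3)[OF that(4,3,1,2)] c(2)[OF that] c(3)[OF that(2,1,3,4)]
    by simp_all
  have "A x u v y = A y v u x" "A x v u y = A y u v x" "A x u v y = A u x y v" "A x v u y = A u y x v"
    using swap assms(2-5) c(1) by metis+
  then show "jacobi_form A u v x y = jacobi_form A u v y x"
    "jacobi_form A u v x y = jacobi_form A x y u v"
    unfolding jacobi_form_def by simp_all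
qed

text \<open>
  Expand the right-hand side: besides \<open>2 * A z x y w\<close> it contains two terms which the Bianchi identity
  combines to a third copy of \<open>A z x y w\<close>.
\<close>

lemma curvature_from_jacobi_form:
  assumes "algebraic_curvature_tensor_on V A" "x \<in> V" "y \<in> V" "z \<in> V" "w \<in> V"
  shows "3 * A z x y w = 2 * jacobi_form A x y z w - 2 * jacobi_form A z y x w"
proof -
  note c = curvature_symmetries[OF assms(1)]
  have "A x z y w = - A z x y w" "A x y z w = - A y x z w" "A z x y w + A x y z w + A y z x w = 0"
    "A z y x w = - A y z x w"
    using c(2,4) assms(2-5) by blast+
  then show ?thesis unfolding jacobi_form_def by (simp add: field_simps)
qed

lemma curvature_operator_represents:
  assumes "zero_model V g A" "a \<in> V" "b \<in> V" "c \<in> V"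
  shows "curvature_operator V g A a b c \<in> V"
    "y \<in> V \<Longrightarrow> g (curvature_operator V g A a b c) y = A a b c y"
proof -
  note m = zero_modelD[OF assms(1)]
  have "linear_form_on V (\<lambda>y. A a b c y)" using m(6) assms(2-4) unfolding multilinear4_on_def by blast
  from theI'[OF form_represented_by_unique_vector[OF m(1,3,5) this]]
  show "curvature_operator V g A a b c \<in> V"
    "y \<in> V \<Longrightarrow> g (curvature_operator V g A a b c) y = A a b c y"
    unfolding curvature_operator_def by blast+
qed

lemma polarized_jacobi_represents:
  assumes "zero_model V g A" "u \<in> V" "v \<in> V" "x \<in> V"
  shows "polarized_jacobi V g A u v x \<in> V"
    "y \<in> V \<Longrightarrow> g (polarized_jacobi V g A u v x) y = jacobi_form A u v x y"
proof -
  note m = zero_modelD[OF assms(1)] and c = curvature_operator_represents[OF assms(1)]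
  let ?p = "curvature_operator V g A x u v" and ?q = "curvature_operator V g A x v u"
  have s: "?p + ?q \<in> V" using c(1) assms(2-4) m(2) by (simp add: subspace_add)
  then show "polarized_jacobi V g A u v x \<in> V"
    unfolding polarized_jacobi_def using m(2) by (simp add: subspace_scale)
  assume y: "y \<in> V"
  show "g (polarized_jacobi V g A u v x) y = jacobi_form A u v x y"
    unfolding polarized_jacobi_def jacobi_form_def
    using bilinear_on_simps(3)[OF m(4) s s y, of "1/2"] bilinear_on_simps(1)[OF m(4), of ?p ?q y]
      c assms(2-4) y by simp
qed

text \<open>
  The definition chooses a basis and an inverse Gram matrix. The columns of that matrix are the
  coordinates of a dual family, so the double sum is the trace of the Jacobi form over a frame, and
  this trace is the same for all frames.
\<close>

lemma higher_jacobi_is_trace: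
  assumes "zero_model V g A" and U: "subspace U" "U \<subseteq> V" "nondegenerate_on U g"
    and F: "frame_of U g I e f" and x: "x \<in> V"
  shows "higher_jacobi V g A U x \<in> V"
    "y \<in> V \<Longrightarrow> g (higher_jacobi V g A U x) y = (\<Sum>i\<in>I. jacobi_form A (e i) (f i) x y)"
proof -
  note m = zero_modelD[OF assms(1)] and pj = polarized_jacobi_represents[OF assms(1)]
  note gU = symmetric_bilinear_on_subset[OF m(3) U(2)]
  note bU = symmetric_imp_bilinear_on[OF gU]
  define B where "B = (SOME B. is_basis_of B U)"
  have "\<exists>B. is_basis_of B U" using fin_dim_subspace_subset[OF m(1) U(1,2)] by metis
  then have B: "is_basis_of B U" unfolding B_def by (rule someI_ex)
  then have fB: "finite B" by (rule is_basis_of_finite[OF m(1) U(2)])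
  have BU: "b \<in> U" if "b \<in> B" for b
    using B that span_base unfolding is_basis_of_def by blast
  then have BV: "b \<in> V" if "b \<in> B" for b using that U(2) by blast
  obtain d where d: "\<And>b. b \<in> B \<Longrightarrow> d b \<in> U"
    "\<And>a b. a \<in> B \<Longrightarrow> b \<in> B \<Longrightarrow> g a (d b) = (if a = b then 1 else 0)"
    using dual_family_exists[OF U(1) gU U(3) fB B] by blast
  have "\<forall>b\<in>B. \<exists>u. d b = (\<Sum>v\<in>B. u v *\<^sub>R v)"
    using d(1) B fB span_finite[OF fB] unfolding is_basis_of_def by auto
  then obtain c where c: "\<And>b. b \<in> B \<Longrightarrow> d b = (\<Sum>v\<in>B. c b v *\<^sub>R v)" by metis
  have "\<exists>\<xi>. \<forall>u\<in>B. \<forall>v\<in>B. (\<Sum>w\<in>B. g u w * \<xi> w v) = (if u = v then 1 else 0)"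
  proof (intro exI[of _ "\<lambda>w v. c v w"] ballI)
    fix u v assume uv: "u \<in> B" "v \<in> B"
    have "g u (d v) = (\<Sum>w\<in>B. c v w * g u w)"
      unfolding c[OF uv(2)] by (rule bilinear_on_sum_right[OF U(1) bU BU BU[OF uv(1)]])
    then show "(\<Sum>w\<in>B. g u w * c v w) = (if u = v then 1 else 0)"
      using d(2)[OF uv] by (simp add: mult.commute)
  qed
  then have \<xi>: "(\<Sum>w\<in>B. g u w * inverse_gram g B w v) = (if u = v then 1 else 0)"
    if "u \<in> B" "v \<in> B" for u v
    using someI_ex[of "\<lambda>\<xi>. \<forall>u\<in>B. \<forall>v\<in>B. (\<Sum>w\<in>B. g u w * \<xi> w v) = (if u = v then 1 else 0)"] that
    unfolding inverse_gram_def by blast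
  \<comment> \<open>The family \<open>d\<close> only served to show that an inverse exists; the chosen inverse has its own dual family.\<close>
  define d' where "d' v = (\<Sum>w\<in>B. inverse_gram g B w v *\<^sub>R w)" for v
  have d': "d' v \<in> U" for v
    unfolding d'_def using U(1) BU by (intro subspace_sum subspace_scale) auto
  have "frame_of U g B (\<lambda>b. b) d'"
  proof (rule frame_of_dual_family[OF U(1) bU fB B d'])
    fix u v assume uv: "u \<in> B" "v \<in> B"
    have "g u (d' v) = (\<Sum>w\<in>B. inverse_gram g B w v * g u w)"
      unfolding d'_def by (rule bilinear_on_sum_right[OF U(1) bU BU BU[OF uv(1)]])
    then show "g u (d' v) = (if u = v then 1 else 0)"
      using \<xi>[OF uv] by (simp add: mult.commute)
  qed
  then have F': "frame_of U g B d' (\<lambda>b. b)" by (rule frame_of_swap[OF U(1) gU U(3)])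
  define t where "t u = (\<Sum>v\<in>B. inverse_gram g B u v *\<^sub>R polarized_jacobi V g A u v x)" for u
  have t: "t u \<in> V" if "u \<in> B" for u
    unfolding t_def using pj(1)[OF BV[OF that] BV x] m(2) by (intro subspace_sum subspace_scale) auto
  have J: "higher_jacobi V g A U x = (\<Sum>u\<in>B. 1 *\<^sub>R t u)"
    unfolding higher_jacobi_def B_def[symmetric] higher_jacobi_basis_def t_def by simp
  show "higher_jacobi V g A U x \<in> V"
    unfolding J using t m(2) by (intro subspace_sum subspace_scale) auto
  assume y: "y \<in> V"
  note jb = jacobi_form_bilinear(1)[OF m(7) x y]
  have "g (higher_jacobi V g A U x) y = (\<Sum>u\<in>B. g (t u) y)"
    unfolding J by (subst bilinear_on_sum_left[OF m(2,4) t y]) auto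
  also have "\<dots> = (\<Sum>u\<in>B. \<Sum>v\<in>B. inverse_gram g B u v * jacobi_form A u v x y)"
  proof (rule sum.cong[OF refl])
    fix u assume u: "u \<in> B"
    show "g (t u) y = (\<Sum>v\<in>B. inverse_gram g B u v * jacobi_form A u v x y)"
      unfolding t_def using pj(2)[OF BV[OF u] BV x y]
      by (subst bilinear_on_sum_left[OF m(2,4) pj(1)[OF BV[OF u] BV x] y]) auto
  qed
  also have "\<dots> = (\<Sum>v\<in>B. \<Sum>u\<in>B. inverse_gram g B u v * jacobi_form A u v x y)"
    by (rule sum.swap)
  also have "\<dots> = (\<Sum>v\<in>B. jacobi_form A (d' v) v x y)"
  proof (rule sum.cong[OF refl])
    fix v assume v: "v \<in> B"
    show "(\<Sum>u\<in>B. inverse_gram g B u v * jacobi_form A u v x y) = jacobi_form A (d' v) v x y"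
      unfolding d'_def by (rule bilinear_on_sum_left[OF m(2) jb BV BV[OF v], symmetric])
  qed
  also have "\<dots> = (\<Sum>i\<in>I. jacobi_form A (e i) (f i) x y)"
    by (rule frame_trace_unique[OF U(1) gU U(3) F' F bilinear_on_subset[OF jb U(2)]])
  finally show "g (higher_jacobi V g A U x) y = (\<Sum>i\<in>I. jacobi_form A (e i) (f i) x y)" .
qed

section \<open>The Ricci operator commutes with every Jacobi operator\<close>

definition linear_operator_on :: "'a::real_vector set \<Rightarrow> ('a \<Rightarrow> 'a) \<Rightarrow> bool" where
  "linear_operator_on V T \<longleftrightarrow>
     (\<forall>x\<in>V. T x \<in> V) \<and> (\<forall>x\<in>V. \<forall>y\<in>V. T (x + y) = T x + T y) \<and>
     (\<forall>c. \<forall>x\<in>V. T (c *\<^sub>R x) = c *\<^sub>R T x)"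

definition self_adjoint_on :: "'a set \<Rightarrow> ('a \<Rightarrow> 'a \<Rightarrow> real) \<Rightarrow> ('a \<Rightarrow> 'a) \<Rightarrow> bool" where
  "self_adjoint_on V h T \<longleftrightarrow> (\<forall>x\<in>V. \<forall>y\<in>V. h (T x) y = h x (T y))"

text \<open>
  Linearity and self-adjointness are read off the trace formula, term by term.
\<close>

lemma higher_jacobi_linear_self_adjoint:
  assumes "zero_model V g A" and U: "subspace U" "U \<subseteq> V" "nondegenerate_on U g"
  shows "linear_operator_on V (higher_jacobi V g A U)"
    "self_adjoint_on V g (higher_jacobi V g A U)"
proof -
  note m = zero_modelD[OF assms(1)]
  note gU = symmetric_bilinear_on_subset[OF m(3) U(2)]
  let ?J = "higher_jacobi V g A U"
  obtain B d where F: "frame_of U g B (\<lambda>b. b) d" using frame_exists[OF m(1) U(1,2) gU U(3)] .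
  then have BV: "b \<in> V" and dV: "d b \<in> V" if "b \<in> B" for b
    using that U(2) unfolding frame_of_def by auto
  note J = higher_jacobi_is_trace[OF assms(1) U F]
  have bj: "bilinear_on V (jacobi_form A b (d b))" if "b \<in> B" for b
    using jacobi_form_bilinear(2)[OF m(7) BV[OF that] dV[OF that]] .
  have "?J (x + y) = ?J x + ?J y" if xy: "x \<in> V" "y \<in> V" for x y
  proof (rule nondegenerate_eqI[OF m(4,2,5)])
    show "?J (x + y) \<in> V" "?J x + ?J y \<in> V" using J(1) xy m(2) by (auto intro: subspace_add)
    fix z assume z: "z \<in> V"
    show "g (?J (x + y)) z = g (?J x + ?J y) z"
      using J[OF xy(1)] J[OF xy(2)] J(2)[OF subspace_add[OF m(2) xy] z] z
        bilinear_on_simps(1)[OF m(4), of "?J x" "?J y" z]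
        bilinear_on_simps(1)[OF bj xy z]
      by (simp add: sum.distrib)
  qed
  moreover have "?J (c *\<^sub>R x) = c *\<^sub>R ?J x" if x: "x \<in> V" for x c
  proof (rule nondegenerate_eqI[OF m(4,2,5)])
    show "?J (c *\<^sub>R x) \<in> V" "c *\<^sub>R ?J x \<in> V" using J(1) x m(2) by (auto intro: subspace_scale)
    fix z assume z: "z \<in> V"
    show "g (?J (c *\<^sub>R x)) z = g (c *\<^sub>R ?J x) z"
      using J[OF x] J(2)[OF subspace_scale[OF m(2) x] z] z
        bilinear_on_simps(3)[OF m(4), of "?J x" z z c]
        bilinear_on_simps(3)[OF bj x z z]
      by (simp add: sum_distrib_left)
  qed
  ultimately show "linear_operator_on V ?J" unfolding linear_operator_on_def using J(1) by blast
  show "self_adjoint_on V g ?J"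
    unfolding self_adjoint_on_def
  proof (intro ballI)
    fix x y assume xy: "x \<in> V" "y \<in> V"
    have "g (?J x) y = g (?J y) x"
      using J(2)[OF xy] J(2)[OF xy(2,1)] jacobi_form_symmetries(2)[OF m(7) BV dV xy] by simp
    then show "g (?J x) y = g x (?J y)"
      using symmetric_bilinear_onD[OF m(3) xy(1) J(1)[OF xy(2)]] by simp
  qed
qed

lemma ricci_operator_is_trace:
  assumes "zero_model V g A" "frame_of V g I e f" "x \<in> V"
  shows "ricci_operator V g A x \<in> V"
    "y \<in> V \<Longrightarrow> g (ricci_operator V g A x) y = (\<Sum>i\<in>I. jacobi_form A (e i) (f i) x y)"
  using higher_jacobi_is_trace[OF assms(1) zero_modelD(2)[OF assms(1)] subset_refl
      zero_modelD(5)[OF assms(1)] assms(2,3)]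
  unfolding ricci_operator_def by blast+

lemma ricci_operator_linear_self_adjoint:
  assumes "zero_model V g A"
  shows "linear_operator_on V (ricci_operator V g A)" "self_adjoint_on V g (ricci_operator V g A)"
  using higher_jacobi_linear_self_adjoint[OF assms zero_modelD(2)[OF assms] subset_refl
      zero_modelD(5)[OF assms]]
  unfolding ricci_operator_def by blast+

lemma ricci_operator_splits:
  assumes "zero_model V g A" and U: "subspace U" "U \<subseteq> V" "nondegenerate_on U g" and x: "x \<in> V"
  shows "ricci_operator V g A x =
    higher_jacobi V g A U x + higher_jacobi V g A (orthogonal_complement V g U) x"
proof -
  note m = zero_modelD[OF assms(1)]
  note C = orthogonal_complement_splits[OF m(1,3,5) U]
  let ?C = "orthogonal_complement V g U"
  obtain B d where F: "frame_of U g B (\<lambda>b. b) d"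
    using frame_exists[OF m(1) U(1,2) symmetric_bilinear_on_subset[OF m(3) U(2)] U(3)] .
  obtain B' d' where F': "frame_of ?C g B' (\<lambda>b. b) d'"
    using frame_exists[OF m(1) C(1,2) symmetric_bilinear_on_subset[OF m(3) C(2)] C(5)] .
  have FV: "frame_of V g (B <+> B') (case_sum (\<lambda>b. b) (\<lambda>b. b)) (case_sum d d')"
    by (rule frame_of_orthogonal_sum[OF m(2,3) U(2) C(2) _ _ F F']) (use C(3,4) in blast)+
  note R = ricci_operator_is_trace[OF assms(1) FV x]
  note J = higher_jacobi_is_trace[OF assms(1) U F x]
  note J' = higher_jacobi_is_trace[OF assms(1) C(1,2,5) F' x]
  have fin: "finite B" "finite B'" using F F' unfolding frame_of_def by auto
  show ?thesis
  proof (rule nondegenerate_eqI[OF m(4,2,5) R(1)])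
    show "higher_jacobi V g A U x + higher_jacobi V g A ?C x \<in> V"
      using J(1) J'(1) m(2) by (simp add: subspace_add)
    fix z assume z: "z \<in> V"
    show "g (ricci_operator V g A x) z = g (higher_jacobi V g A U x + higher_jacobi V g A ?C x) z"
      using bilinear_on_simps(1)[OF m(4) J(1) J'(1) z] R(2)[OF z] J(2)[OF z] J'(2)[OF z] fin
      by (simp add: sum.Plus)
  qed
qed

lemma Puffini_Videv_commutes_with_ricci:
  assumes "zero_model V g A" "Puffini_Videv V g A"
    and U: "subspace U" "U \<subseteq> V" "nondegenerate_on U g" and x: "x \<in> V"
  shows "higher_jacobi V g A U (ricci_operator V g A x) = ricci_operator V g A (higher_jacobi V g A U x)"
proof -
  note m = zero_modelD[OF assms(1)]
  note C = orthogonal_complement_splits[OF m(1,3,5) U]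
  let ?J = "higher_jacobi V g A U" and ?J' = "higher_jacobi V g A (orthogonal_complement V g U)"
  have L: "?J x \<in> V" "?J' x \<in> V" "?J (?J x + ?J' x) = ?J (?J x) + ?J (?J' x)"
    using higher_jacobi_linear_self_adjoint(1)[OF assms(1) U]
      higher_jacobi_linear_self_adjoint(1)[OF assms(1) C(1,2,5)] x
    unfolding linear_operator_on_def by blast+
  have "?J (?J' x) = ?J' (?J x)" using assms(2) U x unfolding Puffini_Videv_def by blast
  then show ?thesis
    using L ricci_operator_splits[OF assms(1) U x] ricci_operator_splits[OF assms(1) U L(1)] by simp
qed

text \<open>
  A null vector \<open>v \<noteq> 0\<close> has a null partner \<open>u\<close> with \<open>g v u \<noteq> 0\<close>, and then \<open>v + t u\<close> is non-null for
  all \<open>t \<noteq> 0\<close>. The quadratic polynomial \<open>C (v + t u) (v + t u)\<close> in \<open>t\<close> vanishes at three points and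
  is therefore zero. Polarization gives the rest.
\<close>

lemma symmetric_form_zero_if_zero_on_nonnull:
  assumes V: "subspace V" "symmetric_bilinear_on V g" "nondegenerate_on V g"
    and C: "symmetric_bilinear_on V C"
    and nn: "\<And>v. v \<in> V \<Longrightarrow> g v v \<noteq> 0 \<Longrightarrow> C v v = 0"
    and "x \<in> V" "y \<in> V"
  shows "C x y = 0"
proof -
  note b = symmetric_imp_bilinear_on[OF V(2)] and c = symmetric_imp_bilinear_on[OF C]
  note gs = symmetric_bilinear_onD[OF V(2)] and cs = symmetric_bilinear_onD[OF C]
  have exp: "h (v + t *\<^sub>R u) (v + t *\<^sub>R u) = h v v + 2 * t * h v u + t\<^sup>2 * h u u"
    if h: "symmetric_bilinear_on V h" and vu: "v \<in> V" "u \<in> V" for h v u t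
  proof -
    have tu: "t *\<^sub>R u \<in> V" "v + t *\<^sub>R u \<in> V" using V(1) vu by (auto intro: subspace_scale subspace_add)
    note hb = symmetric_imp_bilinear_on[OF h]
    show ?thesis
      using symmetric_bilinear_onD[OF h vu] vu tu
      by (simp add: bilinear_on_simps[OF hb] algebra_simps power2_eq_square)
  qed
  have diag: "C v v = 0" if v: "v \<in> V" for v
  proof (cases "g v v = 0 \<and> v \<noteq> 0")
    case False
    then show ?thesis using nn[OF v] bilinear_on_zero[OF c V(1) v] by auto
  next
    case True
    then obtain u0 where u0: "u0 \<in> V" "g v u0 \<noteq> 0" using V(3) v unfolding nondegenerate_on_def by blast
    \<comment> \<open>This multiple of \<open>v\<close> makes \<open>u\<close> null.\<close>
    define s where "s = - g u0 u0 / (2 * g v u0)"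
    define u where "u = u0 + s *\<^sub>R v"
    have u: "u \<in> V" unfolding u_def using u0 v V(1) by (simp add: subspace_add subspace_scale)
    have "g u u = 0"
      unfolding u_def exp[OF V(2) u0(1) v] s_def using True u0(2) gs[OF v u0(1)] by simp
    moreover have "g v u = g v u0"
      unfolding u_def
      using bilinear_on_simps(2)[OF b u0(1) subspace_scale[OF V(1) v] v, of s]
        bilinear_on_simps(4)[OF b v v v, of s] True by simp
    ultimately have "g (v + t *\<^sub>R u) (v + t *\<^sub>R u) \<noteq> 0" if "t \<noteq> 0" for t
      using exp[OF V(2) v u, of t] that True u0(2) by simp
    then have "C v v + 2 * t * C v u + t\<^sup>2 * C u u = 0" if "t \<noteq> 0" for t
      using nn[of "v + t *\<^sub>R u"] exp[OF C v u, of t] that V(1) u v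
      by (simp add: subspace_add subspace_scale)
    from this[of 1] this[of "-1"] this[of 2] show "C v v = 0" by simp
  qed
  show ?thesis
    using exp[OF C assms(6,7), of 1] diag[OF assms(6)] diag[OF assms(7)]
      diag[of "x + y"] assms(6,7) V(1) by (simp add: subspace_add)
qed

text \<open>
  For non-null \<open>x = y\<close> this is the Puffini--Videv condition for the line through \<open>x\<close>. The defect of the
  identity is a symmetric bilinear form in \<open>x, y\<close>, so the preceding lemma covers all other cases.
\<close>

lemma jacobi_form_ricci_self_adjoint:
  assumes "zero_model V g A" "Puffini_Videv V g A" and xy: "x \<in> V" "y \<in> V"
  shows "self_adjoint_on V (jacobi_form A x y) (ricci_operator V g A)"
  unfolding self_adjoint_on_def
proof (intro ballI)
  fix z w assume zw: "z \<in> V" "w \<in> V"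
  note m = zero_modelD[OF assms(1)]
  let ?R = "ricci_operator V g A"
  have RV: "?R z \<in> V" "?R w \<in> V"
    using ricci_operator_linear_self_adjoint(1)[OF assms(1)] zw unfolding linear_operator_on_def by auto
  define C where "C u v = jacobi_form A u v (?R z) w - jacobi_form A u v z (?R w)" for u v
  note b1 = jacobi_form_bilinear(1)[OF m(7) RV(1) zw(2)]
    and b2 = jacobi_form_bilinear(1)[OF m(7) zw(1) RV(2)]
  have C: "symmetric_bilinear_on V C"
    unfolding symmetric_bilinear_on_def
  proof (intro conjI ballI)
    fix u assume u: "u \<in> V"
    show "linear_form_on V (C u)" "linear_form_on V (\<lambda>v. C v u)"
      unfolding linear_form_on_def C_def
      using bilinear_on_simps[OF b1 _ _ u] bilinear_on_simps[OF b2 _ _ u]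
      by (auto simp: algebra_simps)
    show "C u v = C v u" if "v \<in> V" for v
      unfolding C_def using jacobi_form_symmetries(1)[OF m(7) u that] RV zw by simp
  qed
  have "C v v = 0" if v: "v \<in> V" "g v v \<noteq> 0" for v
  proof -
    let ?U = "span {v}" and ?J = "higher_jacobi V g A (span {v})"
    have U: "?U \<subseteq> V" using v(1) m(2) by (simp add: span_minimal)
    have gs: "g (a *\<^sub>R v) (c *\<^sub>R v) = a * c * g v v" for a c
      using bilinear_on_simps(3)[OF m(4) v(1) subspace_scale[OF m(2) v(1)] subspace_scale[OF m(2) v(1)], of a c]
        bilinear_on_simps(4)[OF m(4) v(1) v(1) v(1), of c] by simp
    have nd: "nondegenerate_on ?U g"
      unfolding nondegenerate_on_def
    proof (intro ballI impI)
      fix x assume x: "x \<in> ?U" "\<forall>y\<in>?U. g x y = 0"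
      then obtain a where a: "x = a *\<^sub>R v" by (auto simp: span_singleton)
      have "v \<in> ?U" by (simp add: span_base)
      then have "a * g v v = 0" using x(2) gs[of a 1] a by simp
      then show "x = 0" using a v(2) by simp
    qed
    have F: "frame_of ?U g {()} (\<lambda>_. v) (\<lambda>_. (1 / g v v) *\<^sub>R v)"
      unfolding frame_of_def
    proof (intro conjI ballI)
      fix x assume "x \<in> ?U"
      then obtain a where a: "x = a *\<^sub>R v" by (auto simp: span_singleton)
      then show "x = (\<Sum>i\<in>{()}. g x ((1 / g v v) *\<^sub>R v) *\<^sub>R v)" using gs[of a "1 / g v v"] v(2) by simp
    qed (auto intro: span_scale span_base)
    note J = higher_jacobi_is_trace[OF assms(1) subspace_span U nd F]
    have Jq: "g (?J p) q = jacobi_form A v v p q / g v v" if "p \<in> V" "q \<in> V" for p q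
      using J(2)[OF that] bilinear_on_simps(4)[OF jacobi_form_bilinear(1)[OF m(7) that] v(1) v(1) v(1)]
      by simp
    have "g (?J (?R z)) w = g (?J z) (?R w)"
      using Puffini_Videv_commutes_with_ricci[OF assms(1,2) subspace_span U nd zw(1)]
        ricci_operator_linear_self_adjoint(2)[OF assms(1)] J(1)[OF zw(1)] zw
      unfolding self_adjoint_on_def by simp
    then show "C v v = 0" unfolding C_def using Jq RV zw v(2) by simp
  qed
  from symmetric_form_zero_if_zero_on_nonnull[OF m(2,3,5) C this xy]
  show "jacobi_form A x y (?R z) w = jacobi_form A x y z (?R w)" unfolding C_def by simp
qed

section \<open>Polynomials in an operator\<close>

definition poly_op :: "('a::real_vector \<Rightarrow> 'a) \<Rightarrow> real poly \<Rightarrow> 'a \<Rightarrow> 'a" where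
  "poly_op T p x = (\<Sum>i\<le>degree p. coeff p i *\<^sub>R (T ^^ i) x)"

lemma poly_op_altdef:
  assumes "degree p \<le> n"
  shows "poly_op T p x = (\<Sum>i\<le>n. coeff p i *\<^sub>R (T ^^ i) x)"
  unfolding poly_op_def using assms
  by (intro sum.mono_neutral_left) (auto simp: coeff_eq_0)

lemma poly_op_0 [simp]: "poly_op T 0 x = 0"
  by (simp add: poly_op_def)

lemma poly_op_pCons: "poly_op T (pCons a p) x = a *\<^sub>R x + poly_op T p (T x)"
proof -
  have "poly_op T (pCons a p) x = (\<Sum>i\<le>Suc (degree p). coeff (pCons a p) i *\<^sub>R (T ^^ i) x)"
    by (rule poly_op_altdef) (simp add: degree_pCons_le)
  also have "\<dots> = a *\<^sub>R x + (\<Sum>i\<le>degree p. coeff p i *\<^sub>R (T ^^ Suc i) x)"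
    by (subst sum.atMost_Suc_shift) simp
  finally show ?thesis unfolding poly_op_def by (simp add: funpow_swap1)
qed

lemma poly_op_1: "poly_op T 1 x = x"
  by (simp add: poly_op_def)

lemma poly_op_smult: "poly_op T (smult c p) x = c *\<^sub>R poly_op T p x"
  by (induction p arbitrary: x) (auto simp: poly_op_pCons scaleR_add_right)

lemma poly_op_add: "poly_op T (p + q) x = poly_op T p x + poly_op T q x"
  by (induction p q arbitrary: x rule: poly_induct2) (auto simp: poly_op_pCons scaleR_add_left)

lemma linear_operator_onD:
  assumes "linear_operator_on V T"
  shows "x \<in> V \<Longrightarrow> T x \<in> V" "x \<in> V \<Longrightarrow> y \<in> V \<Longrightarrow> T (x + y) = T x + T y"
    "x \<in> V \<Longrightarrow> T (c *\<^sub>R x) = c *\<^sub>R T x"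
  using assms unfolding linear_operator_on_def by blast+

lemma linear_operator_on_0: "linear_operator_on V T \<Longrightarrow> subspace V \<Longrightarrow> T 0 = 0"
  using linear_operator_onD(3)[of V T 0 0] subspace_0[of V] by simp

lemma linear_operator_on_poly_op:
  assumes "linear_operator_on V T" "subspace V"
  shows "linear_operator_on V (poly_op T p)"
proof (induction p)
  case 0
  then show ?case using assms(2) by (simp add: linear_operator_on_def subspace_0)
next
  case (pCons a p)
  note D = linear_operator_onD[OF assms(1)] and P = linear_operator_onD[OF pCons.IH]
  show ?case
    unfolding linear_operator_on_def poly_op_pCons
    using assms(2) D P
    by (auto simp: subspace_add subspace_scale algebra_simps)
qed

lemma poly_op_commute:
  assumes "linear_operator_on V T" "subspace V" "x \<in> V"
  shows "T (poly_op T p x) = poly_op T p (T x)"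
  using assms(3)
proof (induction p arbitrary: x)
  case 0
  then show ?case using linear_operator_on_0[OF assms(1,2)] by simp
next
  case (pCons a p)
  have "poly_op T p (T x) \<in> V"
    using linear_operator_onD(1)[OF linear_operator_on_poly_op[OF assms(1,2)]]
      linear_operator_onD(1)[OF assms(1)] pCons.prems by blast
  then show ?case
    using linear_operator_onD[OF assms(1)] pCons.prems pCons.IH[of "T x"] assms(2)
    by (simp add: poly_op_pCons subspace_scale)
qed

lemma poly_op_mult:
  assumes "linear_operator_on V T" "subspace V" "x \<in> V"
  shows "poly_op T (p * q) x = poly_op T p (poly_op T q x)"
  using assms(3)
proof (induction p arbitrary: x)
  case (pCons a p)
  have "T x \<in> V" using linear_operator_onD(1)[OF assms(1)] pCons.prems by blast
  with pCons show ?case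
    using poly_op_commute[OF assms(1,2) pCons.prems, of q]
    by (simp add: mult_pCons_left poly_op_add poly_op_smult poly_op_pCons)
qed simp

lemma self_adjoint_on_poly_op:
  assumes "linear_operator_on V T" "subspace V" "bilinear_on V h" "self_adjoint_on V h T"
  shows "self_adjoint_on V h (poly_op T p)"
proof (induction p)
  case 0
  then show ?case using bilinear_on_zero[OF assms(3,2)] by (simp add: self_adjoint_on_def)
next
  case (pCons a p)
  note D = linear_operator_onD[OF assms(1)]
    and P = linear_operator_onD[OF linear_operator_on_poly_op[OF assms(1,2), of p]]
  show ?case
    unfolding self_adjoint_on_def
  proof (intro ballI)
    fix x y assume xy: "x \<in> V" "y \<in> V"
    have "h (poly_op T p (T x)) y = h x (poly_op T p (T y))"
      using pCons.IH assms(4) D(1) P(1) xy poly_op_commute[OF assms(1,2) xy(2), of p]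
      unfolding self_adjoint_on_def by metis
    then show "h (poly_op T (pCons a p) x) y = h x (poly_op T (pCons a p) y)"
      using xy D(1) P(1) assms(2) by (simp add: poly_op_pCons bilinear_on_simps[OF assms(3)] subspace_scale)
  qed
qed

definition ker_on :: "'a::real_vector set \<Rightarrow> ('a \<Rightarrow> 'a) \<Rightarrow> 'a set" where
  "ker_on V S = {x \<in> V. S x = 0}"

lemma subspace_ker_on:
  assumes "linear_operator_on V S" "subspace V"
  shows "subspace (ker_on V S)"
  using linear_operator_onD[OF assms(1)] linear_operator_on_0[OF assms] assms(2)
  unfolding ker_on_def subspace_def by auto

lemma linear_operator_on_ker_poly_op:
  assumes "linear_operator_on V T" "subspace V"
  shows "linear_operator_on (ker_on V (poly_op T p)) T"
proof -
  have "poly_op T p (T x) = 0" if "x \<in> V" "poly_op T p x = 0" for x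
    using poly_op_commute[OF assms that(1), of p] that(2) linear_operator_on_0[OF assms] by simp
  then show ?thesis using assms(1) unfolding linear_operator_on_def ker_on_def by auto
qed

text \<open>
  Among \<open>b, T b, T\<^sup>2 b, \<dots>\<close> more vectors than the dimension are linearly dependent. A repetition in
  this sequence has to be treated apart, as it makes the set of these vectors smaller.
\<close>

lemma vector_annihilator_exists:
  assumes "fin_dim_subspace V" "linear_operator_on V T" "b \<in> V"
  obtains q where "q \<noteq> 0" "poly_op T q b = 0"
proof -
  from assms(1) obtain S where S: "finite S" "V = span S" unfolding fin_dim_subspace_def by blast
  let ?n = "card S" and ?f = "\<lambda>i. (T ^^ i) b"
  have fV: "?f i \<in> V" for i
    by (induction i) (use assms(3) linear_operator_onD(1)[OF assms(2)] in auto)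
  have "\<exists>c. (\<exists>i\<le>?n. c i \<noteq> 0) \<and> (\<Sum>i\<le>?n. c i *\<^sub>R ?f i) = 0"
  proof (cases "inj_on ?f {..?n}")
    case True
    have "card (?f ` {..?n}) = Suc ?n" using card_image[OF True] by simp
    moreover have "?f ` {..?n} \<subseteq> span S" using fV S(2) by auto
    ultimately have "dependent (?f ` {..?n})"
      using independent_span_bound[OF S(1), of "?f ` {..?n}"] by auto
    then obtain u where "\<exists>v\<in>?f ` {..?n}. u v \<noteq> 0" "(\<Sum>v\<in>?f ` {..?n}. u v *\<^sub>R v) = 0"
      by (subst (asm) dependent_finite) auto
    then show ?thesis
      by (intro exI[of _ "\<lambda>i. u (?f i)"]) (auto simp: sum.reindex[OF True])
  next
    case False
    then obtain i j where ij: "i \<le> ?n" "j \<le> ?n" "i \<noteq> j" "?f i = ?f j"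
      unfolding inj_on_def by auto
    define c :: "nat \<Rightarrow> real" where "c k = (if k = i then 1 else 0) - (if k = j then 1 else 0)" for k
    have "(\<Sum>k\<le>?n. c k *\<^sub>R ?f k)
        = (\<Sum>k\<le>?n. if k = i then ?f k else 0) - (\<Sum>k\<le>?n. if k = j then ?f k else 0)"
      unfolding c_def sum_subtractf[symmetric] by (intro sum.cong) auto
    also have "\<dots> = 0" using ij by simp
    finally show ?thesis using ij unfolding c_def by (intro exI[of _ c]) (auto simp: c_def)
  qed
  then obtain c i where c: "i \<le> ?n" "c i \<noteq> 0" "(\<Sum>i\<le>?n. c i *\<^sub>R ?f i) = 0" by blast
  define q where "q = (\<Sum>k\<le>?n. monom (c k) k)"
  have q: "coeff q k = (if k \<le> ?n then c k else 0)" for k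
    unfolding q_def by (simp add: coeff_sum)
  have "degree q \<le> ?n" by (rule degree_le) (simp add: q)
  then have "poly_op T q b = (\<Sum>k\<le>?n. c k *\<^sub>R ?f k)"
    using poly_op_altdef[of q ?n T b] by (simp add: q)
  moreover have "q \<noteq> 0" using q[of i] c by auto
  ultimately show ?thesis using that c(3) by simp
qed

text \<open>
  Multiply annihilators of the finitely many vectors of a spanning set.
\<close>

lemma annihilator_exists:
  assumes "fin_dim_subspace V" "linear_operator_on V T"
  obtains m where "m \<noteq> 0" "\<And>x. x \<in> V \<Longrightarrow> poly_op T m x = 0"
proof -
  from assms(1) obtain S where S: "finite S" "V = span S" unfolding fin_dim_subspace_def by blast
  note sV = fin_dim_subspace_imp_subspace[OF assms(1)]
  have SV: "b \<in> V" if "b \<in> S" for b using S(2) that span_base by blast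
  have "\<forall>b\<in>S. \<exists>q. q \<noteq> 0 \<and> poly_op T q b = 0"
    using vector_annihilator_exists[OF assms SV] by metis
  then obtain q where q: "\<And>b. b \<in> S \<Longrightarrow> q b \<noteq> 0" "\<And>b. b \<in> S \<Longrightarrow> poly_op T (q b) b = 0" by metis
  define m where "m = prod q S"
  note L = linear_operator_on_poly_op[OF assms(2) sV]
  have "poly_op T m b = 0" if b: "b \<in> S" for b
  proof -
    have "m = prod q (S - {b}) * q b"
      unfolding m_def using prod.remove[OF S(1) b, of q] by (simp add: mult.commute)
    then show ?thesis
      using poly_op_mult[OF assms(2) sV SV[OF b]] q(2)[OF b] linear_operator_on_0[OF L sV] by metis
  qed
  then have "S \<subseteq> ker_on V (poly_op T m)" unfolding ker_on_def using SV by auto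
  then have "V \<subseteq> ker_on V (poly_op T m)"
    unfolding S(2) using span_minimal subspace_ker_on[OF L sV] S(2) by metis
  moreover have "m \<noteq> 0" unfolding m_def using q(1) S(1) by simp
  ultimately show ?thesis using that unfolding ker_on_def by blast
qed

lemma coprime_bezout:
  fixes p q :: "real poly"
  assumes "coprime p q"
  obtains u v where "u * p + v * q = 1"
  using assms bezout_coefficients_fst_snd[of p q] by (metis coprime_imp_gcd_eq_1)

text \<open>
  If \<open>u p + v q = 1\<close>, then \<open>x = (v q)(T) x\<close>, and the factor \<open>(v q)(T)\<close> can be moved to \<open>y\<close>, which it
  annihilates.
\<close>

lemma coprime_kernels_orthogonal:
  assumes T: "linear_operator_on V T" "subspace V" and h: "bilinear_on V h" "self_adjoint_on V h T"
    and pq: "coprime p q" and x: "x \<in> ker_on V (poly_op T p)" and y: "y \<in> ker_on V (poly_op T q)"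
  shows "h x y = 0"
proof -
  obtain u v where uv: "u * p + v * q = 1" using coprime_bezout[OF pq] .
  have xy: "x \<in> V" "y \<in> V" "poly_op T p x = 0" "poly_op T q y = 0"
    using x y unfolding ker_on_def by auto
  note z = linear_operator_on_0[OF linear_operator_on_poly_op[OF T] T(2)]
  have "x = poly_op T (u * p + v * q) x" unfolding uv by (simp add: poly_op_1)
  also have "\<dots> = poly_op T (v * q) x"
    unfolding poly_op_add poly_op_mult[OF T xy(1)] xy(3) z by simp
  finally have "h x y = h (poly_op T (v * q) x) y" by simp
  also have "\<dots> = h x (poly_op T (v * q) y)"
    using self_adjoint_on_poly_op[OF T h] xy unfolding self_adjoint_on_def by blast
  also have "\<dots> = 0"
    unfolding poly_op_mult[OF T xy(2)] xy(4) z using bilinear_on_zero[OF h(1) T(2) xy(1)] by simp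
  finally show ?thesis .
qed

text \<open>
  Split off one factor at a time: with \<open>u f\<^sub>a + v r = 1\<close>, where \<open>r\<close> is the product of the other
  factors, \<open>(v r)(T) x\<close> is killed by \<open>f\<^sub>a(T)\<close> and \<open>(u f\<^sub>a)(T) x\<close> by \<open>r(T)\<close>.
\<close>

lemma primary_decomposition:
  assumes T: "linear_operator_on V T" "subspace V"
    and "finite S" "\<And>a b. a \<in> S \<Longrightarrow> b \<in> S \<Longrightarrow> a \<noteq> b \<Longrightarrow> coprime (f a) (f b)"
    and "x \<in> V" "poly_op T (prod f S) x = 0"
  shows "\<exists>w. (\<forall>a\<in>S. w a \<in> ker_on V (poly_op T (f a))) \<and> x = (\<Sum>a\<in>S. w a)"
  using assms(3-)
proof (induction S arbitrary: x rule: finite_induct)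
  case empty
  then show ?case by (simp add: poly_op_1)
next
  case (insert a S)
  have "coprime (f a) (prod f S)"
    using insert.prems(1) insert.hyps by (intro prod_coprime_right) auto
  then obtain u v where uv: "u * f a + v * prod f S = 1" using coprime_bezout by blast
  note L = linear_operator_on_poly_op[OF T]
  note PV = linear_operator_onD(1)[OF L] and M = poly_op_mult[OF T insert.prems(2)]
  have z: "poly_op T (r * (f a * prod f S)) x = 0" for r
    using insert.prems(3) insert.hyps M[of r] linear_operator_on_0[OF L T(2)] by simp
  have 1: "poly_op T (prod f S) (poly_op T (u * f a) x) = 0"
    using z[of u] M[of "prod f S" "u * f a"] by (simp add: mult_ac)
  have 2: "poly_op T (f a) (poly_op T (v * prod f S) x) = 0"
    using z[of v] M[of "f a" "v * prod f S"] by (simp add: mult_ac)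
  obtain w where w: "\<forall>b\<in>S. w b \<in> ker_on V (poly_op T (f b))"
    "poly_op T (u * f a) x = (\<Sum>b\<in>S. w b)"
    using insert.IH[OF _ PV[OF insert.prems(2)] 1] insert.prems(1) by blast
  have x: "x = poly_op T (u * f a) x + poly_op T (v * prod f S) x"
    using poly_op_add[of T "u * f a" "v * prod f S" x] uv by (simp add: poly_op_1)
  let ?w = "w(a := poly_op T (v * prod f S) x)"
  have "(\<Sum>b\<in>S. ?w b) = (\<Sum>b\<in>S. w b)" using insert.hyps by (intro sum.cong) auto
  then have "(\<Sum>b\<in>insert a S. ?w b) = poly_op T (v * prod f S) x + (\<Sum>b\<in>S. w b)"
    using insert.hyps by simp
  then have "x = (\<Sum>b\<in>insert a S. ?w b)" using x w(2) by (metis add.commute)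
  moreover have "\<forall>b\<in>insert a S. ?w b \<in> ker_on V (poly_op T (f b))"
    using w(1) 2 PV[OF insert.prems(2)] unfolding ker_on_def by auto
  ultimately show ?case by blast
qed

section \<open>The spectrum on a primary component\<close>

text \<open>
  The hypotheses on \<open>T\<close> say that \<open>x + i y\<close> is an eigenvector (or zero) of the complexified operator
  for \<open>c\<close>; so \<open>q(T)\<close> acts on it as \<open>q(c)\<close>.
\<close>

lemma poly_op_on_eigenvector:
  assumes T: "linear_operator_on V T" "subspace V" and xy: "x \<in> V" "y \<in> V"
    and eig: "T x = Re c *\<^sub>R x - Im c *\<^sub>R y" "T y = Im c *\<^sub>R x + Re c *\<^sub>R y"
  shows "complexify_map (poly_op T q) (x, y) =
    complexify_scale (poly (map_poly of_real q) c) (x, y)"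
proof (induction q)
  case 0
  then show ?case by (simp add: complexify_map_def complexify_scale_def)
next
  case (pCons a q)
  note P = linear_operator_onD[OF linear_operator_on_poly_op[OF T, of q]]
  have "poly_op T q (T x) = Re c *\<^sub>R poly_op T q x - Im c *\<^sub>R poly_op T q y"
    using P(2)[of "Re c *\<^sub>R x" "(- Im c) *\<^sub>R y"] P(3)[OF xy(1), of "Re c"] P(3)[OF xy(2), of "- Im c"]
      eig(1) xy T(2) by (simp add: subspace_scale subspace_neg)
  moreover have "poly_op T q (T y) = Im c *\<^sub>R poly_op T q x + Re c *\<^sub>R poly_op T q y"
    using P(2)[of "Im c *\<^sub>R x" "Re c *\<^sub>R y"] P(3)[OF xy(1), of "Im c"] P(3)[OF xy(2), of "Re c"]
      eig(2) xy T(2) by (simp add: subspace_scale)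
  moreover define e where "e = poly (map_poly complex_of_real q) c"
  moreover have "poly_op T q x = Re e *\<^sub>R x - Im e *\<^sub>R y" "poly_op T q y = Im e *\<^sub>R x + Re e *\<^sub>R y"
    using pCons.IH unfolding e_def by (simp_all add: complexify_map_def complexify_scale_def)
  moreover have "poly (map_poly complex_of_real (pCons a q)) c = of_real a + c * e"
    unfolding e_def by (simp add: map_poly_pCons)
  ultimately show ?case
    by (simp add: complexify_map_def complexify_scale_def poly_op_pCons algebra_simps)
qed

lemma eigenvalue_is_root:
  assumes T: "linear_operator_on V T" "subspace V"
    and c: "c \<in> complex_eigenvalues V T" and q: "\<And>x. x \<in> V \<Longrightarrow> poly_op T q x = 0"
  shows "poly (map_poly of_real q) c = 0"
proof -
  from c obtain x y where xy: "x \<in> V" "y \<in> V" "(x, y) \<noteq> (0, 0)"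
    "complexify_map T (x, y) = complexify_scale c (x, y)"
    unfolding complex_eigenvalues_def by auto
  let ?e = "poly (map_poly of_real q) c"
  have "complexify_map (poly_op T q) (x, y) = complexify_scale ?e (x, y)"
    using poly_op_on_eigenvector[OF T xy(1,2)] xy(4)
    by (simp add: complexify_map_def complexify_scale_def)
  then have e: "Re ?e *\<^sub>R x = Im ?e *\<^sub>R y" "Im ?e *\<^sub>R x + Re ?e *\<^sub>R y = 0"
    using q xy by (auto simp: complexify_map_def complexify_scale_def)
  \<comment> \<open>A vector \<open>x + i y\<close> killed by a scalar \<open>e\<close> is also killed by \<open>cnj e * e\<close>, which is real.\<close>
  define r s where "r = Re ?e" and "s = Im ?e"
  have e': "r *\<^sub>R x = s *\<^sub>R y" "s *\<^sub>R x + r *\<^sub>R y = 0" using e unfolding r_def s_def .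
  have "(r * r + s * s) *\<^sub>R x = r *\<^sub>R (r *\<^sub>R x) + s *\<^sub>R (s *\<^sub>R x)" by (simp add: scaleR_add_left)
  also have "\<dots> = s *\<^sub>R (s *\<^sub>R x + r *\<^sub>R y)" unfolding e'(1) by (simp add: algebra_simps)
  finally have x0: "(r * r + s * s) *\<^sub>R x = 0" using e'(2) by simp
  have "(r * r + s * s) *\<^sub>R y = r *\<^sub>R (r *\<^sub>R y) + s *\<^sub>R (s *\<^sub>R y)" by (simp add: scaleR_add_left)
  also have "\<dots> = r *\<^sub>R (s *\<^sub>R x + r *\<^sub>R y)" unfolding e'(1)[symmetric] by (simp add: algebra_simps)
  finally have "(r * r + s * s) *\<^sub>R y = 0" using e'(2) by simp
  with x0 xy(3) have "r * r + s * s = 0" by auto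
  then show "?e = 0" unfolding r_def s_def by (simp add: complex_eq_iff sum_squares_eq_zero_iff)
qed

lemma map_poly_of_real_mult:
  "map_poly complex_of_real (p * q) = map_poly of_real p * map_poly of_real q"
  by (rule poly_eqI) (simp add: coeff_mult coeff_map_poly)

lemma map_poly_of_real_add:
  "map_poly complex_of_real (p + q) = map_poly of_real p + map_poly of_real q"
  by (rule poly_eqI) (simp add: coeff_map_poly)

text \<open>
  Take a complex root \<open>c\<close> of \<open>p\<close>. The quadratic is \<open>(X - c) (X - cnj c)\<close>; it shares the root \<open>c\<close> with
  \<open>p\<close>, so it is not coprime to \<open>p\<close>. For real \<open>c\<close> it is the square of \<open>p\<close> up to a unit.
\<close>

lemma irreducible_root_conjugates:
  fixes p :: "real poly"
  assumes "irreducible p"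
  obtains c where "p dvd [:(cmod c)\<^sup>2, - 2 * Re c, 1:]"
    "\<And>d. poly (map_poly of_real p) d = 0 \<Longrightarrow> d = c \<or> d = cnj c"
proof -
  have "degree p \<noteq> 0"
    using assms is_unit_iff_degree[of p] by (auto simp: irreducible_def)
  then have "\<not> constant (poly (map_poly complex_of_real p))"
    by (simp add: constant_degree degree_map_poly)
  then obtain c where c: "poly (map_poly complex_of_real p) c = 0"
    using fundamental_theorem_of_algebra by blast
  let ?q = "[:(cmod c)\<^sup>2, - 2 * Re c, 1:]"
  have q: "poly (map_poly complex_of_real ?q) d = (d - c) * (d - cnj c)" for d
  proof -
    have "poly (map_poly complex_of_real ?q) d = of_real ((cmod c)\<^sup>2) - of_real (2 * Re c) * d + d * d"
      by (simp add: map_poly_pCons algebra_simps)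
    also have "\<dots> = c * cnj c - (c + cnj c) * d + d * d"
      unfolding complex_add_cnj complex_norm_square ..
    finally show ?thesis by (simp add: algebra_simps)
  qed
  have "p dvd ?q"
  proof (rule ccontr)
    assume "\<not> p dvd ?q"
    then have "coprime p ?q"
      using assms irreducible_imp_prime_elem prime_elem_imp_coprime by blast
    then obtain u v where "u * p + v * ?q = 1" using coprime_bezout by blast
    then have "poly (map_poly complex_of_real (u * p + v * ?q)) c = poly (map_poly of_real 1) c" by simp
    then show False
      unfolding map_poly_of_real_add map_poly_of_real_mult poly_add poly_mult c q by simp
  qed
  moreover have "d = c \<or> d = cnj c" if "poly (map_poly of_real p) d = 0" for d
  proof -
    obtain r where "?q = p * r" using \<open>p dvd ?q\<close> by (elim dvdE)
    then have "poly (map_poly complex_of_real ?q) d = 0"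
      using that map_poly_of_real_mult[of p r] by simp
    then show ?thesis unfolding q by simp
  qed
  ultimately show ?thesis using that by blast
qed

lemma kernel_vector_of_nilpotent_power:
  assumes T: "linear_operator_on V T" "subspace V"
    and "x \<in> V" "x \<noteq> 0" "poly_op T (p ^ n) x = 0"
  shows "\<exists>w\<in>V. w \<noteq> 0 \<and> poly_op T p w = 0"
  using assms(3-)
proof (induction n arbitrary: x)
  case 0
  then show ?case by (simp add: poly_op_1)
next
  case (Suc n)
  have "poly_op T (p ^ n) (poly_op T p x) = 0"
    using poly_op_mult[OF T Suc.prems(1), of "p ^ n" p] Suc.prems(3) by (simp add: mult.commute)
  then show ?case
    using Suc.IH[of "poly_op T p x"] Suc.prems
      linear_operator_onD(1)[OF linear_operator_on_poly_op[OF T, of p] Suc.prems(1)] by blast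
qed

text \<open>
  All eigenvalues are roots of \<open>p\<close>, hence in \<open>{c, cnj c}\<close>. Conversely pick \<open>w \<noteq> 0\<close> with \<open>p(T) w = 0\<close>;
  then \<open>(T - c) (T - cnj c) w = 0\<close>. If \<open>c = a + i b\<close> is not real, \<open>(T - cnj c) w\<close> and
  \<open>(T - c) w\<close> are eigenvectors for \<open>c\<close> and \<open>cnj c\<close>, and they are non-zero as their imaginary parts
  are \<open>\<plusminus> b w\<close>. If \<open>c\<close> is real, \<open>w\<close> or \<open>(T - c) w\<close> is an eigenvector.
\<close>

lemma eigenvalues_of_primary_component:
  assumes T: "linear_operator_on V T" "subspace V" and "V \<noteq> {0}"
    and p: "irreducible p" and n: "\<And>x. x \<in> V \<Longrightarrow> poly_op T (p ^ n) x = 0"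
  obtains c where "complex_eigenvalues V T = {c, cnj c}"
proof -
  obtain c where c: "p dvd [:(cmod c)\<^sup>2, - 2 * Re c, 1:]"
    "\<And>d. poly (map_poly of_real p) d = 0 \<Longrightarrow> d = c \<or> d = cnj c"
    using irreducible_root_conjugates[OF p] by blast
  have pow: "poly (map_poly complex_of_real (p ^ k)) d = poly (map_poly of_real p) d ^ k" for k d
    by (induction k) (auto simp: map_poly_of_real_mult)
  have sub: "complex_eigenvalues V T \<subseteq> {c, cnj c}"
  proof
    fix d assume "d \<in> complex_eigenvalues V T"
    then have "poly (map_poly of_real p) d ^ n = 0"
      using eigenvalue_is_root[OF T, of d "p ^ n"] n pow by simp
    then show "d \<in> {c, cnj c}" using c(2)[of d] by simp
  qed
  obtain x where "x \<in> V" "x \<noteq> 0" using assms(3) subspace_0[OF T(2)] by blast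
  then obtain w where w: "w \<in> V" "w \<noteq> 0" "poly_op T p w = 0"
    using kernel_vector_of_nilpotent_power[OF T] n by blast
  define a b where "a = Re c" and "b = Im c"
  obtain r where r: "[:(cmod c)\<^sup>2, - 2 * Re c, 1:] = r * p" using c(1) by (metis dvdE mult.commute)
  have "poly_op T [:(cmod c)\<^sup>2, - 2 * Re c, 1:] w = 0"
    unfolding r poly_op_mult[OF T w(1)] w(3)
    by (rule linear_operator_on_0[OF linear_operator_on_poly_op[OF T] T(2)])
  then have "T (T w) = (a + a) *\<^sub>R T w - (a * a + b * b) *\<^sub>R w"
    unfolding a_def b_def cmod_power2
    by (simp add: poly_op_pCons power2_eq_square algebra_simps add_eq_0_iff)
  then have TT: "T (T w) = a *\<^sub>R T w + a *\<^sub>R T w - (a * a + b * b) *\<^sub>R w"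
    by (simp only: scaleR_add_left)
  note D = linear_operator_onD[OF T(1)]
  define u where "u = T w - a *\<^sub>R w"
  have u: "u \<in> V" unfolding u_def using w(1) D(1) T(2) by (simp add: subspace_diff subspace_scale)
  have Tw: "T w = a *\<^sub>R w + u" unfolding u_def by simp
  have "T u = T (T w) - a *\<^sub>R T w"
    unfolding u_def using D(2)[of "T w" "(- a) *\<^sub>R w"] D(3)[OF w(1), of "- a"] D(1) w(1) T(2)
    by (simp add: subspace_scale subspace_neg)
  then have Tu: "T u = a *\<^sub>R u - (b * b) *\<^sub>R w"
    unfolding TT unfolding Tw by (simp add: algebra_simps)
  have eig: "d \<in> complex_eigenvalues V T" if "x \<in> V" "y \<in> V" "(x, y) \<noteq> (0, 0)"
    "T x = Re d *\<^sub>R x - Im d *\<^sub>R y" "T y = Im d *\<^sub>R x + Re d *\<^sub>R y" for d x y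
    unfolding complex_eigenvalues_def complexify_map_def complexify_scale_def
    using that by (intro CollectI bexI[of _ "(x, y)"]) auto
  have bw: "b *\<^sub>R w \<in> V" "(- b) *\<^sub>R w \<in> V" using w(1) T(2) subspace_scale by blast+
  have Tb: "T (k *\<^sub>R w) = k *\<^sub>R (a *\<^sub>R w + u)" for k using D(3)[OF w(1)] Tw by simp
  have zV: "0 \<in> V" "T 0 = 0" using subspace_0[OF T(2)] linear_operator_on_0[OF T] by auto
  have "c \<in> complex_eigenvalues V T \<and> cnj c \<in> complex_eigenvalues V T"
  proof (cases "b = 0")
    case True
    then have cc: "cnj c = c" "Im c = 0" unfolding b_def by (auto simp: complex_eq_iff)
    have "\<exists>v\<in>V. v \<noteq> 0 \<and> T v = a *\<^sub>R v"
    proof (cases "u = 0")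
      case True
      then show ?thesis using w Tw by auto
    next
      case False
      then show ?thesis using u Tu True by auto
    qed
    then obtain v where "v \<in> V" "v \<noteq> 0" "T v = a *\<^sub>R v" by blast
    then have "c \<in> complex_eigenvalues V T"
      using eig[of v 0 c] zV cc unfolding a_def by simp
    then show ?thesis using cc by simp
  next
    case False
    have "c \<in> complex_eigenvalues V T"
      by (rule eig[OF u bw(1)])
        (use False w(2) Tu Tb[of b] in \<open>auto simp: a_def b_def algebra_simps\<close>)
    moreover have "cnj c \<in> complex_eigenvalues V T"
      by (rule eig[OF u bw(2)])
        (use False w(2) Tu Tb[of "- b"] in \<open>auto simp: a_def b_def algebra_simps\<close>)
    ultimately show ?thesis ..
  qed
  with sub show ?thesis using that by blast
qed

lemma pseudo_EinsteinI:
  assumes "complex_eigenvalues V (ricci_operator V g A) = {c, cnj c}"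
  shows "pseudo_Einstein V g A"
proof (cases "c \<in> \<real>")
  case True
  then show ?thesis using assms unfolding pseudo_Einstein_def by (auto simp: Reals_cnj_iff)
next
  case False
  then show ?thesis
    using assms unfolding pseudo_Einstein_def
    by (intro disjI2 exI[of _ c] exI[of _ "cnj c"]) (auto simp: Reals_cnj_iff)
qed

section \<open>Orthogonal decompositions of models\<close>

text \<open>
  By pair symmetry \<open>jacobi_form A x y z w\<close> is zero unless \<open>x, y\<close> lie in one summand and \<open>z, w\<close> lie
  in one summand, and \<open>curvature_from_jacobi_form\<close> transfers this to \<open>A\<close> except when the arguments
  fall in pairs into two different summands. If \<open>x, y\<close> lie in one summand and \<open>z, w\<close> in another,
  \<open>A x y z w\<close> is already known to vanish. The Bianchi identity then makes \<open>A z x y w\<close> symmetric in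
  \<open>x, y\<close> and so equal to \<open>jacobi_form A x y z w\<close>. Now \<open>curvature_from_jacobi_form\<close> reads
  \<open>3 A z x y w = 2 A z x y w\<close>.
\<close>

lemma curvature_vanishes_on_mixed_arguments:
  assumes A: "algebraic_curvature_tensor_on V A" and W: "\<And>a. a \<in> S \<Longrightarrow> W a \<subseteq> V"
    and J: "\<And>a b x y z w. a \<in> S \<Longrightarrow> b \<in> S \<Longrightarrow> a \<noteq> b \<Longrightarrow> x \<in> V \<Longrightarrow> y \<in> V \<Longrightarrow> z \<in> W a \<Longrightarrow> w \<in> W b \<Longrightarrow>
      jacobi_form A x y z w = 0"
    and S: "a \<in> S" "b \<in> S" "c \<in> S" "d \<in> S" and ne: "\<not> (a = b \<and> b = c \<and> c = d)"
    and v: "z \<in> W a" "x \<in> W b" "y \<in> W c" "w \<in> W d"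
  shows "A z x y w = 0"
proof -
  have J0: "jacobi_form A x y z w = 0"
    if "a \<in> S" "b \<in> S" "c \<in> S" "d \<in> S" "z \<in> W a" "x \<in> W b" "y \<in> W c" "w \<in> W d" "a \<noteq> d \<or> b \<noteq> c"
    for a b c d x y z w
  proof -
    have V: "x \<in> V" "y \<in> V" "z \<in> V" "w \<in> V" using W that by blast+
    show ?thesis
      using that(9) J[OF that(1,4) _ V(1,2) that(5,8)] J[OF that(2,3) _ V(3,4) that(6,7)]
        jacobi_form_symmetries(3)[OF A V] by metis
  qed
  have simple: "A z x y w = 0"
    if "a \<in> S" "b \<in> S" "c \<in> S" "d \<in> S" "z \<in> W a" "x \<in> W b" "y \<in> W c" "w \<in> W d"
      "a \<noteq> d \<or> b \<noteq> c" "a \<noteq> c \<or> b \<noteq> d" for a b c d x y z w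
  proof -
    have V: "x \<in> V" "y \<in> V" "z \<in> V" "w \<in> V" using W that by blast+
    show ?thesis
      using curvature_from_jacobi_form[OF A V] J0[OF that(1-9)]
        J0[OF that(2,1,3,4,6,5,7,8)] that(10) by auto
  qed
  have outer: "A z x y w = 0"
    if "a \<in> S" "b \<in> S" "z \<in> W a" "x \<in> W b" "y \<in> W b" "w \<in> W a" "a \<noteq> b" for a b x y z w
  proof -
    have V: "z \<in> V" "x \<in> V" "y \<in> V" "w \<in> V" using W that by blast+
    have "A x y z w = 0" using simple[OF that(2,2,1,1,4,5,3,6)] that(7) by blast
    then have "A z x y w = A z y x w"
      using curvature_symmetries(4)[OF A V] curvature_symmetries(2)[OF A V(1,3,2,4)] by simp
    then have "jacobi_form A x y z w = A z x y w" unfolding jacobi_form_def by simp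
    moreover have "jacobi_form A z y x w = 0" using J0[OF that(2,1,2,1,4,3,5,6)] that(7) by blast
    ultimately show ?thesis using curvature_from_jacobi_form[OF A V(2,3,1,4)] by simp
  qed
  show ?thesis
  proof (cases "(a \<noteq> d \<or> b \<noteq> c) \<and> (a \<noteq> c \<or> b \<noteq> d)")
    case True
    then show ?thesis using simple[OF S v] by blast
  next
    case False
    have V: "z \<in> V" "x \<in> V" "y \<in> V" "w \<in> V" using W S v by blast+
    from False ne consider "a = d" "b = c" "a \<noteq> b" | "a = c" "b = d" "a \<noteq> b" by blast
    then show ?thesis
    proof cases
      case 1
      then show ?thesis using outer[OF S(1,2) v(1,2)] v by blast
    next
      case 2
      then have "A x z y w = 0" using outer[OF S(2,1) v(2,1)] v by blast
      then show ?thesis using curvature_symmetries(2)[OF A V] by simp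
    qed
  qed
qed

text \<open>
  The summands are only required to span \<open>V\<close>; that the sum is direct follows from orthogonality
  and non-degeneracy (\<open>direct_sum\<close> below).
\<close>

locale orthogonal_decomposition =
  fixes V :: "'a::real_vector set" and g :: "'a \<Rightarrow> 'a \<Rightarrow> real"
    and A :: "'a \<Rightarrow> 'a \<Rightarrow> 'a \<Rightarrow> 'a \<Rightarrow> real" and k :: nat and W :: "nat \<Rightarrow> 'a set"
  assumes model: "zero_model V g A"
    and W_subspace: "i < k \<Longrightarrow> subspace (W i)" and W_subset: "i < k \<Longrightarrow> W i \<subseteq> V"
    and W_sum: "x \<in> V \<Longrightarrow> \<exists>w. (\<forall>i<k. w i \<in> W i) \<and> x = (\<Sum>i<k. w i)"
    and W_orthogonal: "i < k \<Longrightarrow> j < k \<Longrightarrow> i \<noteq> j \<Longrightarrow> x \<in> W i \<Longrightarrow> y \<in> W j \<Longrightarrow> g x y = 0"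
    and A_mixed: "i1 < k \<Longrightarrow> i2 < k \<Longrightarrow> i3 < k \<Longrightarrow> i4 < k \<Longrightarrow> \<not> (i1 = i2 \<and> i2 = i3 \<and> i3 = i4) \<Longrightarrow>
      x1 \<in> W i1 \<Longrightarrow> x2 \<in> W i2 \<Longrightarrow> x3 \<in> W i3 \<Longrightarrow> x4 \<in> W i4 \<Longrightarrow> A x1 x2 x3 x4 = 0"
begin

lemmas m = zero_modelD[OF model]

lemma form_sees_component:
  assumes w: "\<And>j. j < k \<Longrightarrow> w j \<in> W j" and i: "i < k" and y: "y \<in> W i"
  shows "g (\<Sum>j<k. w j) y = g (w i) y"
proof -
  have "g (\<Sum>j<k. 1 *\<^sub>R w j) y = (\<Sum>j<k. 1 * g (w j) y)"
    using w i y W_subset by (intro bilinear_on_sum_left[OF m(2,4)]) auto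
  also have "\<dots> = (\<Sum>j<k. if j = i then g (w i) y else 0)"
    using W_orthogonal[OF _ i _ w y] by (intro sum.cong) auto
  also have "\<dots> = g (w i) y" using i by simp
  finally show ?thesis by simp
qed

lemma nondegenerate_component:
  assumes i: "i < k"
  shows "nondegenerate_on (W i) g"
  unfolding nondegenerate_on_def
proof (intro ballI impI)
  fix x assume x: "x \<in> W i" "\<forall>y\<in>W i. g x y = 0"
  have xV: "x \<in> V" using x(1) W_subset[OF i] by blast
  have "g x v = 0" if v: "v \<in> V" for v
  proof -
    obtain w where w: "\<forall>j<k. w j \<in> W j" "v = (\<Sum>j<k. w j)" using W_sum[OF v] by blast
    have "g v x = g (w i) x" unfolding w(2) using form_sees_component[of w i x] w(1) i x(1) by blast
    moreover have "w i \<in> W i" "w i \<in> V" using w(1) i W_subset by auto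
    ultimately show ?thesis using x(2) symmetric_bilinear_onD[OF m(3) xV] v by metis
  qed
  then show "x = 0" using m(5) xV unfolding nondegenerate_on_def by blast
qed

lemma component_model:
  assumes i: "i < k"
  shows "zero_model (W i) g A"
proof -
  note sub = W_subset[OF i]
  have "fin_dim_subspace (W i)"
    using fin_dim_subspace_subset[OF m(1) W_subspace[OF i] sub]
    unfolding fin_dim_subspace_def is_basis_of_def by metis
  moreover have "algebraic_curvature_tensor_on (W i) A"
    using m(7) sub linear_form_on_subset[OF _ sub]
    unfolding algebraic_curvature_tensor_on_def multilinear4_on_def by (meson subsetD)
  ultimately show ?thesis
    unfolding zero_model_def
    using symmetric_bilinear_on_subset[OF m(3) sub] nondegenerate_component[OF i] by blast
qed

lemma direct_sum: "model_direct_sum V g A k W"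
proof -
  have "\<exists>!w. w \<in> Pi\<^sub>E {..<k} W \<and> v = (\<Sum>i<k. w i)" if v: "v \<in> V" for v
  proof -
    obtain w where w: "\<forall>i<k. w i \<in> W i" "v = (\<Sum>i<k. w i)" using W_sum[OF v] by blast
    show ?thesis
    proof (rule ex1I[of _ "restrict w {..<k}"])
      show "restrict w {..<k} \<in> Pi\<^sub>E {..<k} W \<and> v = (\<Sum>i<k. restrict w {..<k} i)"
        using w by auto
      fix w' assume w': "w' \<in> Pi\<^sub>E {..<k} W \<and> v = (\<Sum>i<k. w' i)"
      then have w'W: "w' j \<in> W j" if "j < k" for j using that by (auto simp: PiE_def Pi_def)
      have "w' i = w i" if i: "i < k" for i
      proof (rule nondegenerate_eqI)
        show "bilinear_on (W i) g" using bilinear_on_subset[OF m(4) W_subset[OF i]] .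
        show "g (w' i) y = g (w i) y" if "y \<in> W i" for y
          using form_sees_component[OF w'W i that] form_sees_component[of w, OF _ i that] w w' by metis
      qed (use W_subspace[OF i] nondegenerate_component[OF i] w'W[OF i] w(1) i in auto)
      then show "w' = restrict w {..<k}" using w' by (intro ext) (auto simp: PiE_def extensional_def)
    qed
  qed
  moreover have "\<forall>i<k. subspace (W i) \<and> W i \<subseteq> V" using W_subspace W_subset by simp
  moreover have "\<forall>i<k. \<forall>j<k. i \<noteq> j \<longrightarrow> (\<forall>x\<in>W i. \<forall>y\<in>W j. g x y = 0)"
    by (intro allI impI ballI) (rule W_orthogonal)
  moreover have "\<forall>i1<k. \<forall>i2<k. \<forall>i3<k. \<forall>i4<k. \<not> (i1 = i2 \<and> i2 = i3 \<and> i3 = i4) \<longrightarrow>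
        (\<forall>x1\<in>W i1. \<forall>x2\<in>W i2. \<forall>x3\<in>W i3. \<forall>x4\<in>W i4. A x1 x2 x3 x4 = 0)"
    by (intro allI impI ballI) (rule A_mixed)
  ultimately show ?thesis unfolding model_direct_sum_def by (intro conjI ballI) simp_all
qed

text \<open>
  Compute \<open>\<rho>\<close> in a frame of \<open>V\<close> put together from frames of \<open>W i\<close> and of its orthogonal complement.
  For \<open>x, y \<in> W i\<close> the complement contributes terms \<open>A x e f y\<close> in which \<open>e\<close> has no component in
  \<open>W i\<close>; these vanish since \<open>A\<close> does not mix summands.
\<close>

lemma ricci_operator_component:
  assumes i: "i < k" and x: "x \<in> W i" and Rx: "ricci_operator V g A x \<in> W i"
  shows "ricci_operator (W i) g A x = ricci_operator V g A x"
proof -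
  note sub = W_subset[OF i] and sW = W_subspace[OF i]
  note cm = zero_modelD[OF component_model[OF i]]
  note C = orthogonal_complement_splits[OF m(1,3,5) sW sub cm(5)]
  let ?C = "orthogonal_complement V g (W i)"
  obtain B d where F: "frame_of (W i) g B (\<lambda>b. b) d"
    using frame_exists[OF m(1) sW sub cm(3,5)] .
  obtain B' d' where F': "frame_of ?C g B' (\<lambda>b. b) d'"
    using frame_exists[OF m(1) C(1,2) symmetric_bilinear_on_subset[OF m(3) C(2)] C(5)] .
  have FV: "frame_of V g (B <+> B') (case_sum (\<lambda>b. b) (\<lambda>b. b)) (case_sum d d')"
    by (rule frame_of_orthogonal_sum[OF m(2,3) sub C(2) _ _ F F']) (use C(3,4) in blast)+
  have fin: "finite B" "finite B'" using F F' unfolding frame_of_def by auto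
  have xV: "x \<in> V" using x sub by blast
  have zero: "jacobi_form A e f x y = 0" if e: "e \<in> ?C" and f: "f \<in> V" and y: "y \<in> W i" for e f y
  proof -
    have yV: "y \<in> V" using y sub by blast
    note jb = jacobi_form_bilinear(1)[OF m(7) xV yV]
    have eV: "e \<in> V" using e C(2) by blast
    obtain w where w: "\<forall>j<k. w j \<in> W j" "e = (\<Sum>j<k. w j)" using W_sum[OF eV] by blast
    obtain v where v: "\<forall>j<k. v j \<in> W j" "f = (\<Sum>j<k. v j)" using W_sum[OF f] by blast
    have wV: "w j \<in> V" "v j \<in> V" if "j < k" for j using w(1) v(1) that W_subset by blast+
    have wi: "w i = 0"
    proof -
      have "g (w i) u = 0" if u: "u \<in> W i" for u
        using form_sees_component[of w, OF _ i u] w e u unfolding orthogonal_complement_def by auto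
      then show ?thesis using cm(5) w(1) i unfolding nondegenerate_on_def by blast
    qed
    have wj: "jacobi_form A (w j) f x y = 0" if j: "j < k" for j
    proof (cases "j = i")
      case True
      then show ?thesis using wi bilinear_on_zero(1)[OF jb m(2) f] by simp
    next
      case False
      have "jacobi_form A (w j) (\<Sum>l<k. 1 *\<^sub>R v l) x y = (\<Sum>l<k. 1 * jacobi_form A (w j) (v l) x y)"
        using wV j by (intro bilinear_on_sum_right[OF m(2) jb]) auto
      also have "\<dots> = 0"
      proof (intro sum.neutral ballI)
        fix l assume l: "l \<in> {..<k}"
        have "A x (w j) (v l) y = 0" "A x (v l) (w j) y = 0"
          using A_mixed[of i j l i x "w j" "v l" y] A_mixed[of i l j i x "v l" "w j" y]
            w(1) v(1) i j l False x y by auto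
        then show "1 * jacobi_form A (w j) (v l) x y = 0" unfolding jacobi_form_def by simp
      qed
      finally show ?thesis using v(2) by simp
    qed
    have "jacobi_form A (\<Sum>j<k. 1 *\<^sub>R w j) f x y = (\<Sum>j<k. 1 * jacobi_form A (w j) f x y)"
      using wV f by (intro bilinear_on_sum_left[OF m(2) jb]) auto
    then show ?thesis using wj w(2) by simp
  qed
  note R = ricci_operator_is_trace[OF model FV xV]
  note Ri = ricci_operator_is_trace[OF component_model[OF i] F x]
  show ?thesis
  proof (rule nondegenerate_eqI[OF cm(4) sW cm(5) Ri(1) Rx])
    fix y assume y: "y \<in> W i"
    have "jacobi_form A b (d' b) x y = 0" if "b \<in> B'" for b
      using zero[OF _ _ y, of b "d' b"] F' that C(2) unfolding frame_of_def by blast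
    then have "g (ricci_operator V g A x) y = (\<Sum>b\<in>B. jacobi_form A b (d b) x y)"
      using R(2)[of y] y sub fin by (auto simp: sum.Plus)
    then show "g (ricci_operator (W i) g A x) y = g (ricci_operator V g A x) y"
      using Ri(2)[OF y] by simp
  qed
qed

end

lemma complex_eigenvalues_cong:
  assumes "\<And>x. x \<in> V \<Longrightarrow> S x = T x"
  shows "complex_eigenvalues V S = complex_eigenvalues V T"
  unfolding complex_eigenvalues_def complexify_map_def using assms by auto

text \<open>
  The zero kernels are left out: a pseudo-Einstein model has an eigenvalue, so its space is not zero.
\<close>

lemma primary_components_exist:
  fixes V :: "'a::real_vector set"
  assumes "fin_dim_subspace V" "linear_operator_on V T" "V \<noteq> {0}"
  obtains k :: nat and p n where "k \<ge> 1" "\<And>i. i < k \<Longrightarrow> irreducible (p i)"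
    "\<And>i j. i < k \<Longrightarrow> j < k \<Longrightarrow> i \<noteq> j \<Longrightarrow> coprime (p i ^ n i) (p j ^ n j)"
    "\<And>i. i < k \<Longrightarrow> ker_on V (poly_op T (p i ^ n i)) \<noteq> {0}"
    "\<And>x. x \<in> V \<Longrightarrow> \<exists>w. (\<forall>i<k. w i \<in> ker_on V (poly_op T (p i ^ n i))) \<and> x = (\<Sum>i<k. w i)"
proof -
  note sV = fin_dim_subspace_imp_subspace[OF assms(1)]
  note L = linear_operator_on_poly_op[OF assms(2) sV]
  obtain q where q: "q \<noteq> 0" "\<And>x. x \<in> V \<Longrightarrow> poly_op T q x = 0" using annihilator_exists[OF assms(1,2)] by blast
  define f where "f a = a ^ multiplicity a q" for a
  let ?K = "\<lambda>a. ker_on V (poly_op T (f a))"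
  define S where "S = {a \<in> prime_factors q. ?K a \<noteq> {0}}"
  have fin: "finite S" unfolding S_def by simp
  have cop: "coprime (f a) (f b)" if "a \<in> prime_factors q" "b \<in> prime_factors q" "a \<noteq> b" for a b
    unfolding f_def using that primes_coprime[of a b] by auto
  obtain r where r: "prod f (prime_factors q) = r * q"
  proof -
    have "q dvd prod f (prime_factors q)" unfolding f_def using prod_prime_factors[OF q(1)] by simp
    then show ?thesis using that by (metis dvdE mult.commute)
  qed
  have dec: "\<exists>w. (\<forall>a\<in>S. w a \<in> ?K a) \<and> x = (\<Sum>a\<in>S. w a)" if x: "x \<in> V" for x
  proof -
    have "poly_op T (prod f (prime_factors q)) x = 0"
      unfolding r poly_op_mult[OF assms(2) sV x] q(2)[OF x] by (rule linear_operator_on_0[OF L sV])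
    from primary_decomposition[OF assms(2) sV _ cop x this]
    obtain w where w: "\<forall>a\<in>prime_factors q. w a \<in> ?K a" "x = (\<Sum>a\<in>prime_factors q. w a)"
      by auto
    have "(\<Sum>a\<in>prime_factors q. w a) = (\<Sum>a\<in>S. w a)"
      by (rule sum.mono_neutral_right) (use w(1) in \<open>auto simp: S_def\<close>)
    then show ?thesis using w unfolding S_def by auto
  qed
  obtain h where h: "bij_betw h {0..<card S} S" using ex_bij_betw_nat_finite[OF fin] by blast
  then have h': "bij_betw h {..<card S} S" by (simp add: atLeast0LessThan)
  have hS: "h i \<in> S" if "i < card S" for i using h' that unfolding bij_betw_def by auto
  show thesis
  proof (rule that[of "card S" h "\<lambda>i. multiplicity (h i) q"])
    have "S \<noteq> {}"
    proof
      assume "S = {}"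
      then have "V \<subseteq> {0}" using dec by auto
      then show False using assms(3) subspace_0[OF sV] by blast
    qed
    then show "1 \<le> card S" using fin by (simp add: Suc_le_eq card_gt_0_iff)
    fix i assume i: "i < card S"
    show "irreducible (h i)" using hS[OF i] unfolding S_def
      by (auto intro!: prime_elem_imp_irreducible prime_imp_prime_elem intro: in_prime_factors_imp_prime)
    show "ker_on V (poly_op T (h i ^ multiplicity (h i) q)) \<noteq> {0}"
      using hS[OF i] unfolding S_def f_def by simp
    show "coprime (h i ^ multiplicity (h i) q) (h j ^ multiplicity (h j) q)"
      if "j < card S" "i \<noteq> j" for j
    proof -
      have "h i \<noteq> h j" using h' i that unfolding bij_betw_def inj_on_def by auto
      then show ?thesis using cop[of "h i" "h j"] hS[OF i] hS[OF that(1)] unfolding S_def f_def by simp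
    qed
  next
    fix x assume "x \<in> V"
    then obtain w where w: "\<forall>a\<in>S. w a \<in> ?K a" "x = (\<Sum>a\<in>S. w a)" using dec by blast
    have "x = (\<Sum>i<card S. w (h i))" unfolding w(2) using sum.reindex_bij_betw[OF h', of w] by simp
    then show "\<exists>w. (\<forall>i<card S. w i \<in> ker_on V (poly_op T (h i ^ multiplicity (h i) q))) \<and>
        x = (\<Sum>i<card S. w i)"
      using w(1) hS unfolding f_def by (intro exI[of _ "\<lambda>i. w (h i)"]) auto
  qed
qed

theorem theorem1p3:
  fixes V :: "'a::real_vector set"
    and g :: "'a \<Rightarrow> 'a \<Rightarrow> real"
    and A :: "'a \<Rightarrow> 'a \<Rightarrow> 'a \<Rightarrow> 'a \<Rightarrow> real"
  assumes "zero_model V g A"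
    and "V \<noteq> {0}"
    and "Puffini_Videv V g A"
  shows "\<exists>k W. k \<ge> 1 \<and> model_direct_sum V g A k W \<and>
           (\<forall>i<k. zero_model (W i) g A \<and> pseudo_Einstein (W i) g A)"
proof -
  note m = zero_modelD[OF assms(1)]
  let ?R = "ricci_operator V g A"
  note lin = ricci_operator_linear_self_adjoint(1)[OF assms(1)]
    and sa = ricci_operator_linear_self_adjoint(2)[OF assms(1)]
  obtain k :: nat and p :: "nat \<Rightarrow> real poly" and n :: "nat \<Rightarrow> nat" where k: "k \<ge> 1"
    and p: "\<And>i. i < k \<Longrightarrow> irreducible (p i)"
    and cop: "\<And>i j. i < k \<Longrightarrow> j < k \<Longrightarrow> i \<noteq> j \<Longrightarrow> coprime (p i ^ n i) (p j ^ n j)"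
    and ne: "\<And>i. i < k \<Longrightarrow> ker_on V (poly_op ?R (p i ^ n i)) \<noteq> {0}"
    and dec: "\<And>x. x \<in> V \<Longrightarrow>
      \<exists>w. (\<forall>i<k. w i \<in> ker_on V (poly_op ?R (p i ^ n i))) \<and> x = (\<Sum>i<k. w i)"
    by (rule primary_components_exist[OF m(1) lin assms(2)]) blast
  define W where "W i = ker_on V (poly_op ?R (p i ^ n i))" for i :: nat
  have WV: "W i \<subseteq> V" for i unfolding W_def ker_on_def by blast
  have W: "subspace (W i)" for i
    unfolding W_def by (rule subspace_ker_on[OF linear_operator_on_poly_op[OF lin m(2)] m(2)])
  interpret orthogonal_decomposition V g A k W
  proof
    show "g x y = 0" if "i < k" "j < k" "i \<noteq> j" "x \<in> W i" "y \<in> W j" for i j x y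
      using coprime_kernels_orthogonal[OF lin m(2,4) sa cop] that unfolding W_def by blast
    have J: "jacobi_form A x y z w = 0"
      if "i \<in> {..<k}" "j \<in> {..<k}" "i \<noteq> j" "x \<in> V" "y \<in> V" "z \<in> W i" "w \<in> W j" for i j x y z w
      using coprime_kernels_orthogonal[OF lin m(2) jacobi_form_bilinear(2)[OF m(7) that(4,5)]
          jacobi_form_ricci_self_adjoint[OF assms(1,3) that(4,5)] cop] that
      unfolding W_def by blast
    show "A x1 x2 x3 x4 = 0"
      if "i1 < k" "i2 < k" "i3 < k" "i4 < k" "\<not> (i1 = i2 \<and> i2 = i3 \<and> i3 = i4)"
        "x1 \<in> W i1" "x2 \<in> W i2" "x3 \<in> W i3" "x4 \<in> W i4" for i1 i2 i3 i4 x1 x2 x3 x4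
      by (rule curvature_vanishes_on_mixed_arguments[OF m(7) WV J, where S = "{..<k}"])
        (use that in auto)
    show "\<exists>w. (\<forall>i<k. w i \<in> W i) \<and> x = (\<Sum>i<k. w i)" if "x \<in> V" for x
      unfolding W_def by (rule dec[OF that])
  qed (rule assms(1) W WV)+
  have "pseudo_Einstein (W i) g A" if i: "i < k" for i
  proof -
    have lW: "linear_operator_on (W i) ?R"
      unfolding W_def by (rule linear_operator_on_ker_poly_op[OF lin m(2)])
    have nW: "W i \<noteq> {0}" using ne[OF i] unfolding W_def .
    have nil: "poly_op ?R (p i ^ n i) x = 0" if "x \<in> W i" for x
      using that unfolding W_def ker_on_def by blast
    obtain c where "complex_eigenvalues (W i) ?R = {c, cnj c}"
      using eigenvalues_of_primary_component[OF lW W nW p[OF i] nil] .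
    moreover have "complex_eigenvalues (W i) (ricci_operator (W i) g A) = complex_eigenvalues (W i) ?R"
      by (rule complex_eigenvalues_cong)
        (rule ricci_operator_component[OF i _ linear_operator_onD(1)[OF lW]])
    ultimately show ?thesis using pseudo_EinsteinI by metis
  qed
  then show ?thesis using k direct_sum component_model by (intro exI[of _ k] exI[of _ W]) simp
qed

end
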